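(* Let $(\mathcal M,g)$ be a pseudo-Riemannian manifold. If every point of $\mathcal M$ has an open neighbourhood on which there is a vector field whose Jacobi operator has maximal rank (that is, rank $\dim\mathcal M-1$ at every point of the neighbourhood), then $\mathcal M$ is locally irreducible.
   Context: All objects are smooth. $\nabla$ is the Levi-Civita connection of $g$, and $R_{XY}Z=\nabla_X\nabla_YZ-\nabla_Y\nabla_XZ-\nabla_{[X,Y]}Z$. The Jacobi operator of a vector field $\xi$ is the $(1,1)$-tensor field $J_\xi:X\mapsto R_{X\xi}\xi$. Its rank at each point is at most $\dim\mathcal M-1$; it has maximal rank if its rank equals $\dim\mathcal M-1$. A pseudo-Riemannian manifold is locally irreducible if no point has an open neighbourhood isometric to a product of two pseudo-Riemannian manifolds of positive dimension. *)

theory Defs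
  imports "HOL-Analysis.Analysis"
begin

section \<open>Smooth maps between Euclidean spaces\<close>

text \<open>These predicates are only applied to open sets \<open>S\<close>.\<close>

fun Ck_on :: "nat \<Rightarrow> 'a::euclidean_space set \<Rightarrow> ('a \<Rightarrow> 'b::real_normed_vector) \<Rightarrow> bool" where
  "Ck_on 0 S f \<longleftrightarrow> continuous_on S f"
| "Ck_on (Suc k) S f \<longleftrightarrow>
     (\<forall>x\<in>S. f differentiable (at x)) \<and>
     (\<forall>v. Ck_on k S (\<lambda>x. frechet_derivative f (at x) v))"

definition smooth_on :: "'a::euclidean_space set \<Rightarrow> ('a \<Rightarrow> 'b::real_normed_vector) \<Rightarrow> bool" where
  "smooth_on S f \<longleftrightarrow> (\<forall>k. Ck_on k S f)"


section \<open>Smooth manifolds\<close>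

text \<open>A chart is a coordinate domain together with a coordinate map; the values of the map
  outside its domain are irrelevant. The dimension of a manifold modelled on \<open>'e\<close> is
  \<open>DIM('e)\<close>, which is always positive.\<close>

type_synonym ('p, 'e) chart = "'p set \<times> ('p \<Rightarrow> 'e)"

record ('p, 'e) manifold =
  man_topology :: "'p topology"
  man_atlas :: "('p, 'e) chart set"

abbreviation points :: "('p, 'e, 'm) manifold_scheme \<Rightarrow> 'p set" where
  "points M \<equiv> topspace (man_topology M)"

abbreviation open_in :: "('p, 'e, 'm) manifold_scheme \<Rightarrow> 'p set \<Rightarrow> bool" where
  "open_in M \<equiv> openin (man_topology M)"

definition chart_inv :: "('p, 'e) chart \<Rightarrow> 'e \<Rightarrow> 'p" where
  "chart_inv c = inv_into (fst c) (snd c)"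

definition transition :: "('p, 'e) chart \<Rightarrow> ('p, 'e) chart \<Rightarrow> 'e \<Rightarrow> 'e" where
  "transition c d = snd d \<circ> chart_inv c"

definition smooth_manifold :: "('p, 'e::euclidean_space, 'm) manifold_scheme \<Rightarrow> bool" where
  "smooth_manifold M \<longleftrightarrow>
     Hausdorff_space (man_topology M) \<and> second_countable (man_topology M) \<and>
     (\<Union>c\<in>man_atlas M. fst c) = points M \<and>
     (\<forall>c\<in>man_atlas M. open_in M (fst c) \<and> open (snd c ` fst c) \<and>
        homeomorphic_map (subtopology (man_topology M) (fst c))
          (top_of_set (snd c ` fst c)) (snd c)) \<and>
     (\<forall>c\<in>man_atlas M. \<forall>d\<in>man_atlas M. smooth_on (snd c ` (fst c \<inter> fst d)) (transition c d))"

definition charts_at :: "('p, 'e, 'm) manifold_scheme \<Rightarrow> 'p \<Rightarrow> ('p, 'e) chart set" where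
  "charts_at M p = {c \<in> man_atlas M. p \<in> fst c}"

definition some_chart :: "('p, 'e, 'm) manifold_scheme \<Rightarrow> 'p \<Rightarrow> ('p, 'e) chart" where
  "some_chart M p = (SOME c. c \<in> charts_at M p)"


section \<open>Tangent vectors, functions and vector fields\<close>

text \<open>A tangent vector at \<open>p\<close> is the family of its coordinate vectors in the charts at \<open>p\<close>,
  related by the derivatives of the transition maps and set to \<open>0\<close> at the other charts. For
  every chart \<open>c\<close> at \<open>p\<close>, the map \<open>v \<mapsto> v c\<close> is a linear isomorphism from the
  tangent space at \<open>p\<close> onto \<open>'e\<close>; the vector space operations are those of the components.\<close>

type_synonym ('p, 'e) tvec = "('p, 'e) chart \<Rightarrow> 'e"

type_synonym ('p, 'e) vfield = "'p \<Rightarrow> ('p, 'e) tvec"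

definition tangent_space ::
  "('p, 'e::euclidean_space, 'm) manifold_scheme \<Rightarrow> 'p \<Rightarrow> ('p, 'e) tvec set" where
  "tangent_space M p = {v.
     (\<forall>c\<in>charts_at M p. \<forall>d\<in>charts_at M p.
        v d = frechet_derivative (transition c d) (at (snd c p)) (v c)) \<and>
     (\<forall>c. c \<notin> charts_at M p \<longrightarrow> v c = 0)}"

definition smooth_function ::
  "('p, 'e::euclidean_space, 'm) manifold_scheme \<Rightarrow> 'p set \<Rightarrow> ('p \<Rightarrow> real) \<Rightarrow> bool" where
  "smooth_function M U f \<longleftrightarrow>
     (\<forall>c\<in>man_atlas M. smooth_on (snd c ` (fst c \<inter> U)) (f \<circ> chart_inv c))"

definition smooth_vfield ::
  "('p, 'e::euclidean_space, 'm) manifold_scheme \<Rightarrow> 'p set \<Rightarrow> ('p, 'e) vfield \<Rightarrow> bool" where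
  "smooth_vfield M U X \<longleftrightarrow>
     (\<forall>p\<in>U. X p \<in> tangent_space M p) \<and>
     (\<forall>c\<in>man_atlas M. smooth_on (snd c ` (fst c \<inter> U)) (\<lambda>x. X (chart_inv c x) c))"

text \<open>The derivative of \<open>f\<close> in the direction of the tangent vector \<open>v\<close> at \<open>p\<close>; it does not
  depend on the chart.\<close>

definition dir_deriv ::
  "('p, 'e::euclidean_space, 'm) manifold_scheme \<Rightarrow> 'p \<Rightarrow> ('p, 'e) tvec \<Rightarrow> ('p \<Rightarrow> real) \<Rightarrow> real" where
  "dir_deriv M p v f =
     (let c = some_chart M p in frechet_derivative (f \<circ> chart_inv c) (at (snd c p)) (v c))"

definition lie_bracket ::
  "('p, 'e::euclidean_space, 'm) manifold_scheme \<Rightarrow> ('p, 'e) vfield \<Rightarrow> ('p, 'e) vfield \<Rightarrow> ('p, 'e) vfield"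
  where
  "lie_bracket M X Y p = (\<lambda>c. if c \<in> charts_at M p
     then frechet_derivative (\<lambda>x. Y (chart_inv c x) c) (at (snd c p)) (X p c)
        - frechet_derivative (\<lambda>x. X (chart_inv c x) c) (at (snd c p)) (Y p c)
     else 0)"


section \<open>Smooth maps and products of manifolds\<close>

definition smooth_map_on ::
  "('p, 'e::euclidean_space, 'm) manifold_scheme \<Rightarrow> 'p set \<Rightarrow>
   ('q, 'f::euclidean_space, 'n) manifold_scheme \<Rightarrow> ('p \<Rightarrow> 'q) \<Rightarrow> bool" where
  "smooth_map_on M U N F \<longleftrightarrow>
     continuous_map (subtopology (man_topology M) U) (man_topology N) F \<and>
     (\<forall>c\<in>man_atlas M. \<forall>d\<in>man_atlas N.
        smooth_on (snd c ` {p \<in> fst c \<inter> U. F p \<in> fst d}) (snd d \<circ> F \<circ> chart_inv c))"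

definition differential ::
  "('p, 'e::euclidean_space, 'm) manifold_scheme \<Rightarrow> ('q, 'f::euclidean_space, 'n) manifold_scheme \<Rightarrow>
   ('p \<Rightarrow> 'q) \<Rightarrow> 'p \<Rightarrow> ('p, 'e) tvec \<Rightarrow> ('q, 'f) tvec" where
  "differential M N F p v = (\<lambda>d. if d \<in> charts_at N (F p)
     then (let c = some_chart M p in
             frechet_derivative (snd d \<circ> F \<circ> chart_inv c) (at (snd c p)) (v c))
     else 0)"

definition prod_chart ::
  "('p1, 'e1) chart \<Rightarrow> ('p2, 'e2) chart \<Rightarrow> ('p1 \<times> 'p2, 'e1 \<times> 'e2) chart" where
  "prod_chart c1 c2 = (fst c1 \<times> fst c2, map_prod (snd c1) (snd c2))"

definition prod_manifold ::
  "('p1, 'e1, 'm1) manifold_scheme \<Rightarrow> ('p2, 'e2, 'm2) manifold_scheme \<Rightarrow>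
   ('p1 \<times> 'p2, 'e1 \<times> 'e2) manifold" where
  "prod_manifold M1 M2 =
     \<lparr>man_topology = prod_topology (man_topology M1) (man_topology M2),
      man_atlas = (\<lambda>(c1, c2). prod_chart c1 c2) ` (man_atlas M1 \<times> man_atlas M2)\<rparr>"


section \<open>Pseudo-Riemannian manifolds\<close>

record ('p, 'e) pr_manifold = "('p, 'e) manifold" +
  metric :: "'p \<Rightarrow> ('p, 'e) tvec \<Rightarrow> ('p, 'e) tvec \<Rightarrow> real"

definition pseudo_riemannian :: "('p, 'e::euclidean_space) pr_manifold \<Rightarrow> bool" where
  "pseudo_riemannian M \<longleftrightarrow> smooth_manifold M \<and>
     (\<forall>p\<in>points M.
        (\<forall>v\<in>tangent_space M p. \<forall>w\<in>tangent_space M p. metric M p v w = metric M p w v) \<and>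
        (\<forall>u\<in>tangent_space M p. \<forall>v\<in>tangent_space M p. \<forall>w\<in>tangent_space M p. \<forall>a b.
           metric M p (\<lambda>c. a *\<^sub>R u c + b *\<^sub>R v c) w = a * metric M p u w + b * metric M p v w) \<and>
        (\<forall>v\<in>tangent_space M p. (\<forall>w\<in>tangent_space M p. metric M p v w = 0) \<longrightarrow> v = (\<lambda>c. 0))) \<and>
     (\<forall>U X Y. open_in M U \<longrightarrow> smooth_vfield M U X \<longrightarrow> smooth_vfield M U Y \<longrightarrow>
        smooth_function M U (\<lambda>p. metric M p (X p) (Y p)))"

definition prod_pr_manifold ::
  "('p1, 'e1::euclidean_space) pr_manifold \<Rightarrow> ('p2, 'e2::euclidean_space) pr_manifold \<Rightarrow>
   ('p1 \<times> 'p2, 'e1 \<times> 'e2) pr_manifold" where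
  "prod_pr_manifold M1 M2 = manifold.extend (prod_manifold M1 M2) (pr_manifold.fields
     (\<lambda>p v w.
        metric M1 (fst p) (differential (prod_manifold M1 M2) M1 fst p v)
                          (differential (prod_manifold M1 M2) M1 fst p w) +
        metric M2 (snd p) (differential (prod_manifold M1 M2) M2 snd p v)
                          (differential (prod_manifold M1 M2) M2 snd p w)))"

text \<open>\<open>F\<close> is an isometry from the open submanifold \<open>U\<close> of \<open>M\<close> onto \<open>N\<close>.\<close>

definition isometry_from ::
  "('p, 'e::euclidean_space) pr_manifold \<Rightarrow> 'p set \<Rightarrow> ('q, 'f::euclidean_space) pr_manifold \<Rightarrow>
   ('p \<Rightarrow> 'q) \<Rightarrow> bool" where
  "isometry_from M U N F \<longleftrightarrow>
     bij_betw F U (points N) \<and>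
     smooth_map_on M U N F \<and> smooth_map_on N (points N) M (inv_into U F) \<and>
     (\<forall>p\<in>U. \<forall>v\<in>tangent_space M p. \<forall>w\<in>tangent_space M p.
        metric N (F p) (differential M N F p v) (differential M N F p w) = metric M p v w)"

text \<open>The two factors are modelled on different Euclidean spaces, over which HOL cannot quantify
  inside a formula; hence the type arguments, which are to be left arbitrary.\<close>

definition locally_irreducible ::
  "('p1, 'e1::euclidean_space) pr_manifold itself \<Rightarrow> ('p2, 'e2::euclidean_space) pr_manifold itself \<Rightarrow>
   ('p, 'e::euclidean_space) pr_manifold \<Rightarrow> bool" where
  "locally_irreducible T1 T2 M \<longleftrightarrow>
     \<not> (\<exists>p\<in>points M. \<exists>U. open_in M U \<and> p \<in> U \<and>
          (\<exists>(M1 :: ('p1, 'e1) pr_manifold) (M2 :: ('p2, 'e2) pr_manifold) F.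
             pseudo_riemannian M1 \<and> pseudo_riemannian M2 \<and>
             isometry_from M U (prod_pr_manifold M1 M2) F))"


section \<open>Levi-Civita connection, curvature and Jacobi operators\<close>

text \<open>A connection acts on vector fields that are smooth on an arbitrary open set \<open>U\<close>. Nothing is
  required of \<open>D X Y p\<close> unless \<open>X\<close> and \<open>Y\<close> are smooth near \<open>p\<close>.\<close>

definition affine_connection ::
  "('p, 'e::euclidean_space, 'm) manifold_scheme \<Rightarrow>
   (('p, 'e) vfield \<Rightarrow> ('p, 'e) vfield \<Rightarrow> ('p, 'e) vfield) \<Rightarrow> bool" where
  "affine_connection M D \<longleftrightarrow>
     (\<forall>U X Y Z f. open_in M U \<longrightarrow>
        smooth_vfield M U X \<longrightarrow> smooth_vfield M U Y \<longrightarrow> smooth_vfield M U Z \<longrightarrow>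
        smooth_function M U f \<longrightarrow>
        smooth_vfield M U (D X Y) \<and>
        (\<forall>p\<in>U.
           D (\<lambda>q c. X q c + Y q c) Z p = (\<lambda>c. D X Z p c + D Y Z p c) \<and>
           D (\<lambda>q c. f q *\<^sub>R X q c) Y p = (\<lambda>c. f p *\<^sub>R D X Y p c) \<and>
           D X (\<lambda>q c. Y q c + Z q c) p = (\<lambda>c. D X Y p c + D X Z p c) \<and>
           D X (\<lambda>q c. f q *\<^sub>R Y q c) p =
             (\<lambda>c. dir_deriv M p (X p) f *\<^sub>R Y p c + f p *\<^sub>R D X Y p c)))"

definition torsion_free ::
  "('p, 'e::euclidean_space, 'm) manifold_scheme \<Rightarrow>
   (('p, 'e) vfield \<Rightarrow> ('p, 'e) vfield \<Rightarrow> ('p, 'e) vfield) \<Rightarrow> bool" where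
  "torsion_free M D \<longleftrightarrow>
     (\<forall>U X Y. open_in M U \<longrightarrow> smooth_vfield M U X \<longrightarrow> smooth_vfield M U Y \<longrightarrow>
        (\<forall>p\<in>U. (\<lambda>c. D X Y p c - D Y X p c) = lie_bracket M X Y p))"

definition metric_compatible ::
  "('p, 'e::euclidean_space) pr_manifold \<Rightarrow>
   (('p, 'e) vfield \<Rightarrow> ('p, 'e) vfield \<Rightarrow> ('p, 'e) vfield) \<Rightarrow> bool" where
  "metric_compatible M D \<longleftrightarrow>
     (\<forall>U X Y Z. open_in M U \<longrightarrow>
        smooth_vfield M U X \<longrightarrow> smooth_vfield M U Y \<longrightarrow> smooth_vfield M U Z \<longrightarrow>
        (\<forall>p\<in>U. dir_deriv M p (X p) (\<lambda>q. metric M q (Y q) (Z q)) =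
           metric M p (D X Y p) (Z p) + metric M p (Y p) (D X Z p)))"

definition levi_civita_connection ::
  "('p, 'e::euclidean_space) pr_manifold \<Rightarrow>
   (('p, 'e) vfield \<Rightarrow> ('p, 'e) vfield \<Rightarrow> ('p, 'e) vfield) \<Rightarrow> bool" where
  "levi_civita_connection M D \<longleftrightarrow>
     affine_connection M D \<and> torsion_free M D \<and> metric_compatible M D"

definition curvature ::
  "('p, 'e::euclidean_space, 'm) manifold_scheme \<Rightarrow>
   (('p, 'e) vfield \<Rightarrow> ('p, 'e) vfield \<Rightarrow> ('p, 'e) vfield) \<Rightarrow>
   ('p, 'e) vfield \<Rightarrow> ('p, 'e) vfield \<Rightarrow> ('p, 'e) vfield \<Rightarrow> ('p, 'e) vfield" where
  "curvature M D X Y Z p =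
     (\<lambda>c. D X (D Y Z) p c - D Y (D X Z) p c - D (lie_bracket M X Y) Z p c)"

definition jacobi_operator ::
  "('p, 'e::euclidean_space, 'm) manifold_scheme \<Rightarrow>
   (('p, 'e) vfield \<Rightarrow> ('p, 'e) vfield \<Rightarrow> ('p, 'e) vfield) \<Rightarrow>
   ('p, 'e) vfield \<Rightarrow> ('p, 'e) vfield \<Rightarrow> ('p, 'e) vfield" where
  "jacobi_operator M D \<xi> X = curvature M D X \<xi> \<xi>"

text \<open>The rank at \<open>p\<close> of a \<open>(1,1)\<close>-tensor field, given as an operator \<open>A\<close> on vector fields.
  Every tangent vector at \<open>p\<close> is the value of a field that is smooth near \<open>p\<close>, so the vectors
  \<open>A X p\<close> make up the image of the endomorphism of the tangent space at \<open>p\<close> induced by \<open>A\<close>;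
  the dimension of this image is computed in a chart.\<close>

definition tensor_rank ::
  "('p, 'e::euclidean_space, 'm) manifold_scheme \<Rightarrow>
   (('p, 'e) vfield \<Rightarrow> ('p, 'e) vfield) \<Rightarrow> 'p \<Rightarrow> nat" where
  "tensor_rank M A p =
     dim {A X p (some_chart M p) |X. \<exists>U. open_in M U \<and> p \<in> U \<and> smooth_vfield M U X}"

definition jacobi_maximal_rank ::
  "('p, 'e::euclidean_space, 'm) manifold_scheme \<Rightarrow>
   (('p, 'e) vfield \<Rightarrow> ('p, 'e) vfield \<Rightarrow> ('p, 'e) vfield) \<Rightarrow> 'p set \<Rightarrow> ('p, 'e) vfield \<Rightarrow> bool" where
  "jacobi_maximal_rank M D U \<xi> \<longleftrightarrow>
     (\<forall>q\<in>U. tensor_rank M (jacobi_operator M D \<xi>) q = DIM('e) - 1)"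

end

theory Submission
  imports Defs
begin

text \<open>Suppose that an open set is isometric to a product of two pseudo-Riemannian manifolds. Decompose
  a vector field as \<open>\<xi> = \<xi>\<^sub>1 + \<xi>\<^sub>2\<close> along the two factors. The curvature of a product splits, so for
  a vector \<open>a\<close> tangent to the first factor \<open>R(a, \<xi>)\<xi> = R(a, \<xi>\<^sub>1)\<xi>\<^sub>1\<close>. If \<open>\<xi>\<^sub>1 \<noteq> 0\<close> at a
  point, then \<open>a = \<xi>\<^sub>1\<close> lies in the kernel of the Jacobi operator there; if \<open>\<xi>\<^sub>1 = 0\<close>, then every \<open>a\<close>
  does. The same holds for the second factor. The kernel thus contains two independent vectors,
  and at every point the Jacobi operator of every vector field has rank at most \<open>dim M - 2\<close>
  (\<open>rank_jacobi_operator_le\<close>).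

  The splitting of the curvature is derived in the coordinates that a product chart induces on the open
  set through the isometry. There a torsion-free connection is given by Christoffel symbols, and its
  curvature by the usual tensor formed from them (\<open>curvature_eq_riemann\<close>); this also shows that the
  Jacobi operator acts pointwise, as a linear map. The metric in these coordinates is a sum of a metric on each
  factor that depends on the coordinates of this factor only (\<open>split_metric\<close>). By the Koszul formula the
  Christoffel symbols inherit this form, and with them the curvature (\<open>riemann_P\<close>).\<close>


section \<open>Calculus of smooth maps\<close>

lemma frechet_derivative_cong_open:
  assumes "open S" "x \<in> S" "\<And>y. y \<in> S \<Longrightarrow> f y = g y"
  shows "frechet_derivative f (at x) = frechet_derivative g (at x)"
proof -
  have "(f has_derivative D) (at x) \<longleftrightarrow> (g has_derivative D) (at x)" for D
    using assms has_derivative_transform_within_open by metis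
  then show ?thesis by (simp add: frechet_derivative_def)
qed

lemma differentiable_cong_open:
  assumes "open S" "x \<in> S" "\<And>y. y \<in> S \<Longrightarrow> f y = g y" "f differentiable (at x)"
  shows "g differentiable (at x)"
  using assms has_derivative_transform_within_open unfolding differentiable_def by metis

lemma has_frechet_derivative:
  "f differentiable (at x) \<Longrightarrow> (f has_derivative frechet_derivative f (at x)) (at x)"
  by (simp add: frechet_derivative_works)

lemma frechet_derivative_eqI:
  "(f has_derivative D) (at x) \<Longrightarrow> frechet_derivative f (at x) v = D v"
  using frechet_derivative_at by metis

lemma frechet_derivative_expand_basis:
  fixes v :: "'a::euclidean_space"
  assumes "f differentiable (at x)"
  shows "frechet_derivative f (at x) v = (\<Sum>b\<in>Basis. (v \<bullet> b) *\<^sub>R frechet_derivative f (at x) b)"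
proof -
  have l: "linear (frechet_derivative f (at x))"
    by (rule linear_frechet_derivative[OF assms])
  have "frechet_derivative f (at x) v = frechet_derivative f (at x) (\<Sum>b\<in>Basis. (v \<bullet> b) *\<^sub>R b)"
    by (simp add: euclidean_representation)
  then show ?thesis by (simp only: linear_sum[OF l] linear_cmul[OF l])
qed

lemma Ck_on_imp_continuous_on: "Ck_on k S f \<Longrightarrow> continuous_on S f"
  by (cases k) (auto intro!: continuous_at_imp_continuous_on differentiable_imp_continuous_within)

lemma Ck_on_Suc_imp_Ck_on: "Ck_on (Suc k) S f \<Longrightarrow> Ck_on k S f"
proof (induction k arbitrary: f)
  case 0
  then show ?case using Ck_on_imp_continuous_on[OF 0] by simp
next
  case (Suc k)
  then show ?case by (metis Ck_on.simps(2))
qed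

lemma Ck_on_subset: "Ck_on k S f \<Longrightarrow> T \<subseteq> S \<Longrightarrow> Ck_on k T f"
  by (induction k arbitrary: f) (auto intro: continuous_on_subset)

lemma Ck_on_cong:
  assumes "open S" "\<And>x. x \<in> S \<Longrightarrow> f x = g x" "Ck_on k S f"
  shows "Ck_on k S g"
  using assms(2,3)
proof (induction k arbitrary: f g)
  case 0
  then show ?case using continuous_on_cong[of S S f g] by simp
next
  case (Suc k)
  have "g differentiable (at x)" if "x \<in> S" for x
    using Suc.prems that differentiable_cong_open[OF assms(1) that, of f g] by simp
  moreover have "Ck_on k S (\<lambda>x. frechet_derivative g (at x) v)" for v
  proof (rule Suc.IH)
    show "Ck_on k S (\<lambda>x. frechet_derivative f (at x) v)" using Suc.prems by simp
    show "frechet_derivative f (at x) v = frechet_derivative g (at x) v" if "x \<in> S" for x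
      using frechet_derivative_cong_open[OF assms(1) that, of f g] Suc.prems by simp
  qed
  ultimately show ?case by simp
qed

lemma Ck_on_local:
  assumes "\<And>x. x \<in> S \<Longrightarrow> \<exists>T. open T \<and> x \<in> T \<and> Ck_on k T f"
  shows "Ck_on k S f"
  using assms
proof (induction k arbitrary: f)
  case 0
  then show ?case
    by (auto intro!: continuous_at_imp_continuous_on simp: continuous_on_eq_continuous_at)
      (metis continuous_on_eq_continuous_at)
next
  case (Suc k)
  have "f differentiable (at x)" if "x \<in> S" for x
    using Suc.prems[OF that] by auto
  moreover have "Ck_on k S (\<lambda>x. frechet_derivative f (at x) v)" for v
    by (rule Suc.IH) (use Suc.prems in fastforce)
  ultimately show ?case by simp
qed

lemma Ck_on_const: "Ck_on k S (\<lambda>x. c)"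
  by (induction k arbitrary: c) auto

lemma Ck_on_bounded_linear:
  assumes "open S" "bounded_linear L" "Ck_on k S f"
  shows "Ck_on k S (\<lambda>x. L (f x))"
  using assms(3)
proof (induction k arbitrary: f)
  case 0
  then show ?case using bounded_linear.continuous_on[OF assms(2)] by auto
next
  case (Suc k)
  have d: "((\<lambda>x. L (f x)) has_derivative (\<lambda>v. L (frechet_derivative f (at x) v))) (at x)"
    if "x \<in> S" for x
    using Suc.prems that by (auto intro!: bounded_linear.has_derivative[OF assms(2)] has_frechet_derivative)
  have "Ck_on k S (\<lambda>x. frechet_derivative (\<lambda>x. L (f x)) (at x) v)" for v
  proof (rule Ck_on_cong[OF assms(1)])
    show "Ck_on k S (\<lambda>x. L (frechet_derivative f (at x) v))"
      using Suc.prems by (auto intro!: Suc.IH)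
  qed (simp add: d[THEN frechet_derivative_eqI])
  then show ?case using d by (auto simp: differentiable_def)
qed

lemma Ck_on_add:
  assumes "open S" "Ck_on k S f" "Ck_on k S g"
  shows "Ck_on k S (\<lambda>x. f x + g x)"
  using assms(2,3)
proof (induction k arbitrary: f g)
  case 0
  then show ?case by (auto intro: continuous_on_add)
next
  case (Suc k)
  have d: "((\<lambda>x. f x + g x) has_derivative
      (\<lambda>v. frechet_derivative f (at x) v + frechet_derivative g (at x) v)) (at x)"
    if "x \<in> S" for x
    using Suc.prems that by (auto intro!: has_derivative_add has_frechet_derivative)
  have "Ck_on k S (\<lambda>x. frechet_derivative (\<lambda>x. f x + g x) (at x) v)" for v
  proof (rule Ck_on_cong[OF assms(1)])
    show "Ck_on k S (\<lambda>x. frechet_derivative f (at x) v + frechet_derivative g (at x) v)"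
      using Suc.prems by (auto intro!: Suc.IH)
  qed (simp add: d[THEN frechet_derivative_eqI])
  then show ?case using d by (auto simp: differentiable_def)
qed

lemma Ck_on_bounded_bilinear:
  assumes "open S" "bounded_bilinear B" "Ck_on k S f" "Ck_on k S g"
  shows "Ck_on k S (\<lambda>x. B (f x) (g x))"
  using assms(3,4)
proof (induction k arbitrary: f g)
  case 0
  then show ?case using bounded_bilinear.continuous_on[OF assms(2)] by auto
next
  case (Suc k)
  have d: "((\<lambda>x. B (f x) (g x)) has_derivative
      (\<lambda>v. B (f x) (frechet_derivative g (at x) v) + B (frechet_derivative f (at x) v) (g x))) (at x)"
    if "x \<in> S" for x
    using Suc.prems that
    by (auto intro!: bounded_bilinear.FDERIV[OF assms(2)] has_frechet_derivative)
  have "Ck_on k S (\<lambda>x. frechet_derivative (\<lambda>x. B (f x) (g x)) (at x) v)" for v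
  proof (rule Ck_on_cong[OF assms(1)])
    show "Ck_on k S (\<lambda>x. B (f x) (frechet_derivative g (at x) v) + B (frechet_derivative f (at x) v) (g x))"
      using Suc.prems Suc.prems[THEN Ck_on_Suc_imp_Ck_on]
      by (intro Ck_on_add[OF assms(1)] Suc.IH) simp_all
  qed (simp add: d[THEN frechet_derivative_eqI])
  then show ?case using d by (auto simp: differentiable_def)
qed

lemma Ck_on_sum:
  assumes "open S" "finite I" "\<And>i. i \<in> I \<Longrightarrow> Ck_on k S (f i)"
  shows "Ck_on k S (\<lambda>x. \<Sum>i\<in>I. f i x)"
  using assms(2,3) by induction (auto intro!: Ck_on_const Ck_on_add[OF assms(1)])

text \<open>By the chain rule the derivative of \<open>f \<circ> g\<close> in the direction \<open>v\<close> is a sum, over a basis, of products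
  of a coefficient of \<open>Dg v\<close> with a partial derivative of \<open>f\<close> composed with \<open>g\<close>; this is what makes an
  induction on the order of differentiability possible.\<close>

lemma Ck_on_compose:
  fixes g :: "'a::euclidean_space \<Rightarrow> 'b::euclidean_space"
  assumes "open S" "open T" "g ` S \<subseteq> T" "Ck_on k S g" "Ck_on k T f"
  shows "Ck_on k S (f \<circ> g)"
  using assms(4,5)
proof (induction k arbitrary: f)
  case 0
  then show ?case using assms(3) continuous_on_subset[of T f "g ` S"] continuous_on_compose[of S g f] by simp
next
  case (Suc k)
  have f: "f differentiable (at (g x))" and
    d: "((f \<circ> g) has_derivative
      frechet_derivative f (at (g x)) \<circ> frechet_derivative g (at x)) (at x)"
    if "x \<in> S" for x
    using Suc.prems that assms(3)
    by (auto intro!: diff_chain_at has_frechet_derivative)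
  have IH: "Ck_on k S (\<lambda>x. ((\<lambda>y. frechet_derivative f (at y) b) \<circ> g) x)" for b
    using Suc.IH[of "\<lambda>y. frechet_derivative f (at y) b"] Suc.prems(2)
      Ck_on_Suc_imp_Ck_on[OF Suc.prems(1)] by (simp add: comp_def)
  have "Ck_on k S (\<lambda>x. frechet_derivative (f \<circ> g) (at x) v)" for v
  proof (rule Ck_on_cong[OF assms(1)])
    show "Ck_on k S (\<lambda>x. \<Sum>b\<in>Basis. (frechet_derivative g (at x) v \<bullet> b) *\<^sub>R
        ((\<lambda>y. frechet_derivative f (at y) b) \<circ> g) x)"
      using Suc.prems Suc.prems[THEN Ck_on_Suc_imp_Ck_on]
      by (intro Ck_on_sum[OF assms(1)] Ck_on_bounded_bilinear[OF assms(1) bounded_bilinear_scaleR]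
        Ck_on_bounded_linear[OF assms(1) bounded_linear_inner_left] IH) auto
    show "(\<Sum>b\<in>Basis. (frechet_derivative g (at x) v \<bullet> b) *\<^sub>R
        ((\<lambda>y. frechet_derivative f (at y) b) \<circ> g) x) = frechet_derivative (f \<circ> g) (at x) v"
      if "x \<in> S" for x
      using d[OF that, THEN frechet_derivative_eqI, of v]
        frechet_derivative_expand_basis[OF f[OF that], of "frechet_derivative g (at x) v"] by simp
  qed
  then show ?case using d by (simp only: Ck_on.simps) (blast intro: differentiableI)
qed

lemma smooth_on_imp_continuous_on: "smooth_on S f \<Longrightarrow> continuous_on S f"
  by (auto simp: smooth_on_def intro: Ck_on_imp_continuous_on)

lemma smooth_on_imp_differentiable: "smooth_on S f \<Longrightarrow> x \<in> S \<Longrightarrow> f differentiable (at x)"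
  unfolding smooth_on_def using Ck_on.simps(2)[of 0 S f] by simp

lemma smooth_on_imp_has_derivative:
  "smooth_on S f \<Longrightarrow> x \<in> S \<Longrightarrow> (f has_derivative frechet_derivative f (at x)) (at x)"
  by (intro has_frechet_derivative smooth_on_imp_differentiable)

lemma smooth_on_imp_linear_derivative:
  "smooth_on S f \<Longrightarrow> x \<in> S \<Longrightarrow> linear (frechet_derivative f (at x))"
  by (intro linear_frechet_derivative smooth_on_imp_differentiable)

lemma smooth_on_dir_derivative: "smooth_on S f \<Longrightarrow> smooth_on S (\<lambda>x. frechet_derivative f (at x) v)"
  unfolding smooth_on_def using Ck_on.simps(2)[of _ S f] by simp

lemma smooth_on_subset: "smooth_on S f \<Longrightarrow> T \<subseteq> S \<Longrightarrow> smooth_on T f"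
  by (auto simp: smooth_on_def intro: Ck_on_subset)

lemma smooth_on_cong:
  "open S \<Longrightarrow> (\<And>x. x \<in> S \<Longrightarrow> f x = g x) \<Longrightarrow> smooth_on S f \<Longrightarrow> smooth_on S g"
  unfolding smooth_on_def using Ck_on_cong[of S f g] by simp

lemma smooth_on_local:
  "(\<And>x. x \<in> S \<Longrightarrow> \<exists>T. open T \<and> x \<in> T \<and> smooth_on T f) \<Longrightarrow> smooth_on S f"
  unfolding smooth_on_def by (intro allI Ck_on_local) meson

lemma smooth_on_const: "smooth_on S (\<lambda>x. c)"
  by (simp add: smooth_on_def Ck_on_const)

lemma smooth_on_bounded_linear:
  "open S \<Longrightarrow> bounded_linear L \<Longrightarrow> smooth_on S f \<Longrightarrow> smooth_on S (\<lambda>x. L (f x))"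
  by (simp add: smooth_on_def Ck_on_bounded_linear)

lemma smooth_on_inner:
  fixes f :: "'a::euclidean_space \<Rightarrow> 'b::euclidean_space"
  shows "open S \<Longrightarrow> smooth_on S f \<Longrightarrow> smooth_on S (\<lambda>x. f x \<bullet> b)"
  by (rule smooth_on_bounded_linear[OF _ bounded_linear_inner_left])

lemma smooth_on_add:
  "open S \<Longrightarrow> smooth_on S f \<Longrightarrow> smooth_on S g \<Longrightarrow> smooth_on S (\<lambda>x. f x + g x)"
  by (simp add: smooth_on_def Ck_on_add)

lemma smooth_on_scaleR:
  "open S \<Longrightarrow> smooth_on S f \<Longrightarrow> smooth_on S g \<Longrightarrow> smooth_on S (\<lambda>x. f x *\<^sub>R g x)"
  by (simp add: smooth_on_def Ck_on_bounded_bilinear[OF _ bounded_bilinear_scaleR])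

lemma smooth_on_diff:
  assumes "open S" "smooth_on S f" "smooth_on S g"
  shows "smooth_on S (\<lambda>x. f x - g x)"
  using smooth_on_add[OF assms(1,2) smooth_on_bounded_linear[OF assms(1) _ assms(3), of "\<lambda>x. - x"]]
  by (simp add: bounded_linear_minus bounded_linear_ident)

lemma smooth_on_sum:
  "open S \<Longrightarrow> finite I \<Longrightarrow> (\<And>i. i \<in> I \<Longrightarrow> smooth_on S (f i)) \<Longrightarrow> smooth_on S (\<lambda>x. \<Sum>i\<in>I. f i x)"
  by (simp add: smooth_on_def Ck_on_sum)

lemma smooth_on_compose:
  fixes g :: "'a::euclidean_space \<Rightarrow> 'b::euclidean_space"
  shows "open S \<Longrightarrow> open T \<Longrightarrow> g ` S \<subseteq> T \<Longrightarrow> smooth_on S g \<Longrightarrow> smooth_on T f \<Longrightarrow>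
    smooth_on S (\<lambda>x. f (g x))"
  unfolding smooth_on_def using Ck_on_compose[of S T g _ f] by (simp add: comp_def)

lemma smooth_on_apply_derivative:
  fixes f :: "'a::euclidean_space \<Rightarrow> 'b::real_normed_vector"
  assumes "open S" "smooth_on S f" "smooth_on S Y"
  shows "smooth_on S (\<lambda>x. frechet_derivative f (at x) (Y x))"
proof (rule smooth_on_cong[OF assms(1)])
  show "smooth_on S (\<lambda>x. \<Sum>b\<in>Basis. (Y x \<bullet> b) *\<^sub>R frechet_derivative f (at x) b)"
    using assms by (intro smooth_on_sum smooth_on_scaleR smooth_on_inner smooth_on_dir_derivative) auto
qed (rule frechet_derivative_expand_basis[OF smooth_on_imp_differentiable[OF assms(2)], symmetric])

lemma frechet_derivative_chain:
  assumes "f differentiable (at (g x))" "g differentiable (at x)"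
  shows "frechet_derivative (\<lambda>x. f (g x)) (at x) v
    = frechet_derivative f (at (g x)) (frechet_derivative g (at x) v)"
  using frechet_derivative_compose[OF assms(2,1)] by (simp add: comp_def)

lemma has_real_derivative_along_line:
  fixes f :: "'a::real_normed_vector \<Rightarrow> real"
  assumes "f differentiable (at (x + s *\<^sub>R u))"
  shows "((\<lambda>s. f (x + s *\<^sub>R u)) has_real_derivative frechet_derivative f (at (x + s *\<^sub>R u)) u) (at s)"
proof -
  have "((\<lambda>s. x + s *\<^sub>R u) has_derivative (\<lambda>t. t *\<^sub>R u)) (at s)"
    by (auto intro!: derivative_eq_intros)
  from diff_chain_at[OF this has_frechet_derivative[OF assms]]
  have "((\<lambda>s. f (x + s *\<^sub>R u)) has_derivative
      (\<lambda>t. frechet_derivative f (at (x + s *\<^sub>R u)) (t *\<^sub>R u))) (at s)"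
    by (simp add: comp_def)
  moreover have "(\<lambda>t. frechet_derivative f (at (x + s *\<^sub>R u)) (t *\<^sub>R u))
      = (*) (frechet_derivative f (at (x + s *\<^sub>R u)) u)"
    using linear_cmul[OF linear_frechet_derivative[OF assms]] by (auto simp: mult.commute)
  ultimately show ?thesis by (simp add: has_field_derivative_def)
qed

text \<open>The second difference of \<open>f\<close> over a parallelogram is, by applying the mean value theorem
  in the direction \<open>u\<close> and then in the direction \<open>v\<close>, a value of the mixed derivative.\<close>

lemma second_difference_eq_mixed_derivative:
  fixes f :: "'a::euclidean_space \<Rightarrow> real"
  assumes "t > 0"
    and seg: "\<And>a b. 0 \<le> a \<Longrightarrow> a \<le> t \<Longrightarrow> 0 \<le> b \<Longrightarrow> b \<le> t \<Longrightarrow> x + a *\<^sub>R u + b *\<^sub>R v \<in> S"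
    and f: "smooth_on S f"
  obtains a b where "0 \<le> a" "a \<le> t" "0 \<le> b" "b \<le> t"
    "f (x + t *\<^sub>R u + t *\<^sub>R v) - f (x + t *\<^sub>R u) - f (x + t *\<^sub>R v) + f x
      = t * t * frechet_derivative (\<lambda>y. frechet_derivative f (at y) u) (at (x + a *\<^sub>R u + b *\<^sub>R v)) v"
proof -
  let ?g = "\<lambda>y. frechet_derivative f (at y) u"
  let ?\<phi> = "\<lambda>s. f (x + t *\<^sub>R v + s *\<^sub>R u) - f (x + s *\<^sub>R u)"
  have "\<exists>a. 0 < a \<and> a < t \<and> ?\<phi> t - ?\<phi> 0
      = (t - 0) * (?g (x + t *\<^sub>R v + a *\<^sub>R u) - ?g (x + a *\<^sub>R u))"
  proof (rule MVT2)
    fix s assume s: "0 \<le> s" "s \<le> t"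
    show "(?\<phi> has_real_derivative ?g (x + t *\<^sub>R v + s *\<^sub>R u) - ?g (x + s *\<^sub>R u)) (at s)"
      using seg[OF s, of t] seg[OF s, of 0] s assms(1)
      by (intro DERIV_diff has_real_derivative_along_line smooth_on_imp_differentiable[OF f])
        (auto simp: ac_simps)
  qed (use assms in simp)
  then obtain a where a: "0 < a" "a < t"
    "?\<phi> t - ?\<phi> 0 = t * (?g (x + t *\<^sub>R v + a *\<^sub>R u) - ?g (x + a *\<^sub>R u))" by auto
  let ?\<chi> = "\<lambda>s. ?g (x + a *\<^sub>R u + s *\<^sub>R v)"
  have "\<exists>b. 0 < b \<and> b < t \<and> ?\<chi> t - ?\<chi> 0
      = (t - 0) * frechet_derivative ?g (at (x + a *\<^sub>R u + b *\<^sub>R v)) v"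
  proof (rule MVT2)
    fix s assume s: "0 \<le> s" "s \<le> t"
    show "(?\<chi> has_real_derivative frechet_derivative ?g (at (x + a *\<^sub>R u + s *\<^sub>R v)) v) (at s)"
      using seg[OF _ _ s, of a] a
      by (intro has_real_derivative_along_line smooth_on_imp_differentiable[OF smooth_on_dir_derivative[OF f]])
        auto
  qed (use assms in simp)
  then obtain b where b: "0 < b" "b < t"
    "?\<chi> t - ?\<chi> 0 = t * frechet_derivative ?g (at (x + a *\<^sub>R u + b *\<^sub>R v)) v" by auto
  show ?thesis
    using a b by (intro that[of a b]) (auto simp: ac_simps)
qed

text \<open>The second difference is symmetric in \<open>u\<close> and \<open>v\<close>, so near \<open>x\<close> each of the two mixed derivatives
  takes a value that the other one takes as well. If they differed at \<open>x\<close>, they would be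
  separated near \<open>x\<close> by continuity.\<close>

lemma symmetric_second_derivative_real:
  fixes f :: "'a::euclidean_space \<Rightarrow> real"
  assumes "open S" "x \<in> S" and f: "smooth_on S f"
  shows "frechet_derivative (\<lambda>y. frechet_derivative f (at y) u) (at x) v
    = frechet_derivative (\<lambda>y. frechet_derivative f (at y) v) (at x) u" (is "?A x = ?B x")
proof (rule ccontr)
  assume ne: "?A x \<noteq> ?B x"
  define e where "e = \<bar>?A x - ?B x\<bar> / 2"
  have e: "e > 0" using ne by (simp add: e_def)
  have "continuous_on S ?A" "continuous_on S ?B"
    by (intro smooth_on_imp_continuous_on smooth_on_dir_derivative f)+
  then have "isCont ?A x" "isCont ?B x"
    using assms by (auto simp: continuous_on_eq_continuous_at)
  then obtain d1 d2 where d1: "d1 > 0" "\<And>y. dist y x < d1 \<Longrightarrow> dist (?A y) (?A x) < e"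
    and d2: "d2 > 0" "\<And>y. dist y x < d2 \<Longrightarrow> dist (?B y) (?B x) < e"
    using e unfolding continuous_at_eps_delta by metis
  obtain d3 where d3: "d3 > 0" "ball x d3 \<subseteq> S" using assms openE by metis
  define d where "d = Min {d1, d2, d3}"
  have d: "d > 0" "d \<le> d1" "d \<le> d2" "d \<le> d3" using d1 d2 d3 by (auto simp: d_def)
  \<comment> \<open>The parallelogram with sides \<open>t u\<close> and \<open>t v\<close> stays within distance \<open>d\<close> of \<open>x\<close>.\<close>
  define t where "t = d / (2 * (norm u + norm v + 1))"
  have t: "t > 0" using d by (simp add: t_def add_nonneg_pos)
  have small: "dist (x + a *\<^sub>R u + b *\<^sub>R v) x < d" if "0 \<le> a" "a \<le> t" "0 \<le> b" "b \<le> t" for a b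
  proof -
    have "dist (x + a *\<^sub>R u + b *\<^sub>R v) x \<le> norm (a *\<^sub>R u) + norm (b *\<^sub>R v)"
      by (simp only: dist_norm add.assoc add_diff_cancel_left' norm_triangle_ineq)
    also have "\<dots> \<le> t * norm u + t * norm v"
      using that by (auto intro!: add_mono mult_right_mono)
    also have "\<dots> < t * (2 * (norm u + norm v + 1))"
      using t by (simp add: algebra_simps) (smt (verit) mult_nonneg_nonneg norm_ge_zero)
    also have "\<dots> = d"
      unfolding t_def using add_nonneg_pos[OF add_nonneg_nonneg[OF norm_ge_zero[of u] norm_ge_zero[of v]], of 1]
      by simp
    finally show ?thesis .
  qed
  then have S: "x + a *\<^sub>R u + b *\<^sub>R v \<in> S" "x + b *\<^sub>R v + a *\<^sub>R u \<in> S"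
    if "0 \<le> a" "a \<le> t" "0 \<le> b" "b \<le> t" for a b
  proof -
    have "x + a *\<^sub>R u + b *\<^sub>R v \<in> ball x d3"
      using small[OF that] d(4) by (simp add: dist_commute)
    then show "x + a *\<^sub>R u + b *\<^sub>R v \<in> S" "x + b *\<^sub>R v + a *\<^sub>R u \<in> S"
      using d3(2) by (auto simp: add.assoc add.commute[of "b *\<^sub>R v"])
  qed
  obtain a b where ab: "0 \<le> a" "a \<le> t" "0 \<le> b" "b \<le> t"
    "f (x + t *\<^sub>R u + t *\<^sub>R v) - f (x + t *\<^sub>R u) - f (x + t *\<^sub>R v) + f x
      = t * t * ?A (x + a *\<^sub>R u + b *\<^sub>R v)"
    by (rule second_difference_eq_mixed_derivative[OF t S(1) f])
  obtain a' b' where ab': "0 \<le> a'" "a' \<le> t" "0 \<le> b'" "b' \<le> t"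
    "f (x + t *\<^sub>R v + t *\<^sub>R u) - f (x + t *\<^sub>R v) - f (x + t *\<^sub>R u) + f x
      = t * t * ?B (x + a' *\<^sub>R v + b' *\<^sub>R u)"
    by (rule second_difference_eq_mixed_derivative[OF t S(2) f])
  have "t * t * ?A (x + a *\<^sub>R u + b *\<^sub>R v) = t * t * ?B (x + a' *\<^sub>R v + b' *\<^sub>R u)"
    using ab(5) ab'(5) unfolding add.assoc[of x] add.commute[of "t *\<^sub>R v"] by linarith
  then have eq: "?A (x + a *\<^sub>R u + b *\<^sub>R v) = ?B (x + a' *\<^sub>R v + b' *\<^sub>R u)" using t by simp
  have "dist (x + a *\<^sub>R u + b *\<^sub>R v) x < d1" using small[OF ab(1-4)] d by simp
  moreover have "dist (x + a' *\<^sub>R v + b' *\<^sub>R u) x < d2"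
    using small[OF ab'(3,4) ab'(1,2)] d by (simp add: ac_simps)
  ultimately have "dist (?A (x + a *\<^sub>R u + b *\<^sub>R v)) (?A x) < e"
    "dist (?B (x + a' *\<^sub>R v + b' *\<^sub>R u)) (?B x) < e"
    using d1 d2 by blast+
  then show False unfolding eq dist_real_def e_def by (simp add: abs_if split: if_splits)
qed

lemma symmetric_second_derivative:
  fixes f :: "'a::euclidean_space \<Rightarrow> 'b::euclidean_space"
  assumes "open S" "x \<in> S" and f: "smooth_on S f"
  shows "frechet_derivative (\<lambda>y. frechet_derivative f (at y) u) (at x) v
    = frechet_derivative (\<lambda>y. frechet_derivative f (at y) v) (at x) u"
proof (rule euclidean_eqI)
  fix b :: 'b assume "b \<in> Basis"
  have comp: "frechet_derivative (\<lambda>y. g y \<bullet> b) (at y) w = frechet_derivative g (at y) w \<bullet> b"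
    if "smooth_on S g" "y \<in> S" for g :: "'a \<Rightarrow> 'b" and y w
    by (rule frechet_derivative_eqI, rule has_derivative_inner_left,
        rule smooth_on_imp_has_derivative[OF that])
  have "frechet_derivative (\<lambda>y. frechet_derivative f (at y) u) (at x) v \<bullet> b
      = frechet_derivative (\<lambda>y. frechet_derivative (\<lambda>y. f y \<bullet> b) (at y) u) (at x) v" for u v
    unfolding comp[OF smooth_on_dir_derivative[OF f] assms(2), symmetric]
    by (rule fun_cong[OF frechet_derivative_cong_open[OF assms(1,2)]]) (rule comp[OF f, symmetric])
  then show "frechet_derivative (\<lambda>y. frechet_derivative f (at y) u) (at x) v \<bullet> b
      = frechet_derivative (\<lambda>y. frechet_derivative f (at y) v) (at x) u \<bullet> b"
    using symmetric_second_derivative_real[OF assms(1,2) smooth_on_inner[OF assms(1) f, of b]] by simp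
qed

lemma has_vector_derivative_along_line:
  fixes f :: "'a::real_normed_vector \<Rightarrow> 'b::real_normed_vector"
  assumes "f differentiable (at x)"
  shows "((\<lambda>t. f (x + t *\<^sub>R u)) has_vector_derivative frechet_derivative f (at x) u) (at 0)"
proof -
  have "((\<lambda>t. x + t *\<^sub>R u) has_derivative (\<lambda>t. t *\<^sub>R u)) (at 0)"
    by (auto intro!: derivative_eq_intros)
  from diff_chain_at[OF this, of f "frechet_derivative f (at x)"] has_frechet_derivative[OF assms]
  have "((\<lambda>t. f (x + t *\<^sub>R u)) has_derivative (\<lambda>t. frechet_derivative f (at x) (t *\<^sub>R u))) (at 0)"
    by (simp add: comp_def)
  then show ?thesis
    by (simp add: has_vector_derivative_def linear_cmul[OF linear_frechet_derivative[OF assms]])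
qed

text \<open>A directional derivative is determined by the restriction of the function to a line. This turns
  \<open>the metric does not depend on the second factor\<close> into statements about its derivatives.\<close>

lemma frechet_derivative_eq_along_lines:
  fixes f :: "'a::real_normed_vector \<Rightarrow> 'b::real_normed_vector" and g :: "'c::real_normed_vector \<Rightarrow> 'b"
  assumes S: "open S" "x \<in> S" and T: "open T" "y \<in> T"
    and f: "f differentiable (at x)" and g: "g differentiable (at y)"
    and eq: "\<And>t. x + t *\<^sub>R u \<in> S \<Longrightarrow> y + t *\<^sub>R v \<in> T \<Longrightarrow> f (x + t *\<^sub>R u) = g (y + t *\<^sub>R v)"
  shows "frechet_derivative f (at x) u = frechet_derivative g (at y) v"
proof (rule vector_derivative_unique_at)
  let ?A = "((\<lambda>t. x + t *\<^sub>R u) -` S) \<inter> ((\<lambda>t. y + t *\<^sub>R v) -` T)"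
  have "open ?A"
    using S T by (intro open_Int open_vimage continuous_intros) auto
  then show "((\<lambda>t. g (y + t *\<^sub>R v)) has_vector_derivative frechet_derivative f (at x) u) (at 0)"
    using S T eq
    by (intro has_vector_derivative_transform_within_open[OF has_vector_derivative_along_line[OF f], of ?A]) auto
qed (rule has_vector_derivative_along_line[OF g])

text \<open>Extend the two kernel vectors to a basis: the images of the other basis vectors span the range.\<close>

lemma dim_range_two_kernel_vectors:
  fixes L :: "'a::euclidean_space \<Rightarrow> 'b::euclidean_space"
  assumes L: "linear L" "L a = 0" "L b = 0" and ab: "independent {a, b}" "a \<noteq> b"
  shows "dim (range L) + 2 \<le> DIM('a)"
proof -
  obtain B where B: "{a, b} \<subseteq> B" "independent B" "UNIV \<subseteq> span B"
    using maximal_independent_subset_extend[OF subset_UNIV ab(1)] by metis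
  have fin: "finite B" "card B \<le> DIM('a)" using independent_bound[OF B(2)] by auto
  have "range L \<subseteq> span (L ` (B - {a, b}))"
  proof -
    have "range L = span (L ` B)"
      using B(3) linear_span_image[OF L(1), of B] by (metis UNIV_I subsetI subset_antisym)
    moreover have "L ` B \<subseteq> insert 0 (L ` (B - {a, b}))" using L by auto
    ultimately show ?thesis using span_mono span_insert_0 by metis
  qed
  then have "dim (range L) \<le> card (L ` (B - {a, b}))"
    using fin by (intro dim_le_card) auto
  also have "\<dots> \<le> card (B - {a, b})" using fin by (intro card_image_le) auto
  also have "\<dots> = card B - 2" using B(1) ab(2) fin by (subst card_Diff_subset) auto
  finally have "dim (range L) \<le> card B - 2" .
  moreover have "2 \<le> card B" using card_mono[OF fin(1) B(1)] ab(2) by simp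
  ultimately show ?thesis using fin(2) by linarith
qed


section \<open>Coordinate systems with values in an arbitrary Euclidean space\<close>

lemma inj_on_chart:
  assumes "smooth_manifold M" "c \<in> man_atlas M"
  shows "inj_on (snd c) (fst c)"
proof -
  have "fst c \<subseteq> points M"
    using assms openin_subset unfolding smooth_manifold_def by blast
  moreover have "homeomorphic_map (subtopology (man_topology M) (fst c))
      (top_of_set (snd c ` fst c)) (snd c)"
    using assms unfolding smooth_manifold_def by blast
  ultimately show ?thesis
    by (metis homeomorphic_imp_injective_map topspace_subtopology_subset)
qed

lemma chart_inv_chart:
  "smooth_manifold M \<Longrightarrow> c \<in> man_atlas M \<Longrightarrow> p \<in> fst c \<Longrightarrow> chart_inv c (snd c p) = p"
  unfolding chart_inv_def by (intro inv_into_f_f inj_on_chart)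

lemma open_chart_image:
  assumes "smooth_manifold M" "c \<in> man_atlas M" "open_in M A"
  shows "open (snd c ` (A \<inter> fst c))"
proof -
  have "homeomorphic_map (subtopology (man_topology M) (fst c))
      (top_of_set (snd c ` fst c)) (snd c)" and o: "open (snd c ` fst c)"
    using assms unfolding smooth_manifold_def by blast+
  then have "open_map (subtopology (man_topology M) (fst c)) (top_of_set (snd c ` fst c)) (snd c)"
    by (simp add: homeomorphic_imp_open_map)
  moreover have "openin (subtopology (man_topology M) (fst c)) (A \<inter> fst c)"
    using assms(3) by (rule openin_subtopology_Int)
  ultimately show ?thesis
    using o openin_open_eq unfolding open_map_def by blast
qed

lemma open_in_chart_domain: "smooth_manifold M \<Longrightarrow> c \<in> man_atlas M \<Longrightarrow> open_in M (fst c)"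
  by (auto simp: smooth_manifold_def)

lemma charts_atD: "c \<in> charts_at M q \<Longrightarrow> c \<in> man_atlas M" "c \<in> charts_at M q \<Longrightarrow> q \<in> fst c"
  by (auto simp: charts_at_def)

lemma some_chart_in_charts_at:
  assumes "smooth_manifold M" "q \<in> points M"
  shows "some_chart M q \<in> charts_at M q"
proof -
  have "\<exists>c. c \<in> charts_at M q" using assms unfolding smooth_manifold_def charts_at_def by blast
  then show ?thesis unfolding some_chart_def by (rule someI_ex)
qed

lemma smooth_transition:
  "smooth_manifold M \<Longrightarrow> c \<in> man_atlas M \<Longrightarrow> d \<in> man_atlas M \<Longrightarrow>
    smooth_on (snd c ` (fst c \<inter> fst d)) (transition c d)"
  by (simp add: smooth_manifold_def)

lemma transition_differentiable:
  assumes "smooth_manifold M" "c \<in> charts_at M q" "d \<in> charts_at M q"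
  shows "transition c d differentiable (at (snd c q))"
proof (rule smooth_on_imp_differentiable)
  show "smooth_on (snd c ` (fst c \<inter> fst d)) (transition c d)"
    using assms by (auto simp: charts_at_def intro: smooth_transition)
qed (use assms in \<open>auto simp: charts_at_def\<close>)

lemma smooth_vfield_cong:
  assumes "smooth_manifold M" "open_in M V" "smooth_vfield M V X" "\<And>q. q \<in> V \<Longrightarrow> X q = Y q"
  shows "smooth_vfield M V Y"
  unfolding smooth_vfield_def
proof (intro conjI ballI)
  fix c assume c: "c \<in> man_atlas M"
  have o: "open (snd c ` (fst c \<inter> V))"
    using open_chart_image[OF assms(1) c assms(2)] by (simp add: Int_commute)
  show "smooth_on (snd c ` (fst c \<inter> V)) (\<lambda>x. Y (chart_inv c x) c)"
    by (rule smooth_on_cong[OF o, of "\<lambda>x. X (chart_inv c x) c"])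
      (use assms c in \<open>auto simp: smooth_vfield_def chart_inv_chart[OF assms(1)]\<close>)
qed (use assms in \<open>auto simp: smooth_vfield_def\<close>)

lemma smooth_function_cong:
  assumes "smooth_manifold M" "open_in M V" "smooth_function M V f" "\<And>q. q \<in> V \<Longrightarrow> f q = g q"
  shows "smooth_function M V g"
  unfolding smooth_function_def
proof
  fix c assume c: "c \<in> man_atlas M"
  have o: "open (snd c ` (fst c \<inter> V))"
    using open_chart_image[OF assms(1) c assms(2)] by (simp add: Int_commute)
  show "smooth_on (snd c ` (fst c \<inter> V)) (g \<circ> chart_inv c)"
    by (rule smooth_on_cong[OF o, of "f \<circ> chart_inv c"])
      (use assms c in \<open>auto simp: smooth_function_def chart_inv_chart[OF assms(1)]\<close>)
qed

lemma smooth_function_const: "smooth_function M V (\<lambda>q. a)"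
  by (simp add: smooth_function_def comp_def smooth_on_const)

lemma smooth_vfield_subset: "smooth_vfield M V X \<Longrightarrow> V' \<subseteq> V \<Longrightarrow> smooth_vfield M V' X"
  unfolding smooth_vfield_def by (meson Int_mono image_mono order_refl smooth_on_subset subsetD)

text \<open>The model space \<open>'k\<close> of the coordinates need not be the space \<open>'e\<close> on which the atlas
  is modelled. This makes room for coordinates with values in the product of the model spaces of
  two factors, which can be used without turning the product into a chart of the atlas.\<close>

locale coordinates =
  fixes M :: "('p, 'e::euclidean_space, 'm) manifold_scheme"
    and V :: "'p set"
    and \<psi> :: "'p \<Rightarrow> 'k::euclidean_space"
    and \<eta> :: "'k \<Rightarrow> 'p"
  assumes manifold: "smooth_manifold M"
    and open_domain: "open_in M V"
    and inverse: "q \<in> V \<Longrightarrow> \<eta> (\<psi> q) = q"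
    and open_image: "c \<in> man_atlas M \<Longrightarrow> open (\<psi> ` (V \<inter> fst c))"
    and smooth_inverse: "c \<in> man_atlas M \<Longrightarrow> smooth_on (\<psi> ` (V \<inter> fst c)) (\<lambda>z. snd c (\<eta> z))"
    and smooth_coords: "c \<in> man_atlas M \<Longrightarrow> smooth_on (snd c ` (V \<inter> fst c)) (\<lambda>x. \<psi> (chart_inv c x))"
begin

text \<open>The coordinates identify the tangent space at a point \<open>q\<close> with \<open>'k\<close>. The two directions of this
  identification are \<open>coord_vec q\<close> and \<open>coord_comp q\<close>; the latter is evaluated in the selected chart at \<open>q\<close>,
  and all charts at \<open>q\<close> give the same value. None of the definitions mentions the domain \<open>V\<close>, so their
  values do not change when the domain is made smaller.\<close>

definition coord_vec :: "'p \<Rightarrow> 'k \<Rightarrow> ('p, 'e) tvec" where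
  "coord_vec q k = (\<lambda>c. if c \<in> charts_at M q
     then frechet_derivative (\<lambda>z. snd c (\<eta> z)) (at (\<psi> q)) k else 0)"

definition coord_comp :: "'p \<Rightarrow> ('p, 'e) tvec \<Rightarrow> 'k" where
  "coord_comp q v = (let c = some_chart M q in
     frechet_derivative (\<lambda>x. \<psi> (chart_inv c x)) (at (snd c q)) (v c))"

definition coord_field :: "('k \<Rightarrow> 'k) \<Rightarrow> ('p, 'e) vfield" where
  "coord_field Y = (\<lambda>q. coord_vec q (Y (\<psi> q)))"

definition coord_rep :: "('p, 'e) vfield \<Rightarrow> 'k \<Rightarrow> 'k" where
  "coord_rep X z = coord_comp (\<eta> z) (X (\<eta> z))"

lemma domain_subset: "V \<subseteq> points M"
  using open_domain openin_subset by blast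

lemma image_eq_Union: "\<psi> ` V = (\<Union>c\<in>man_atlas M. \<psi> ` (V \<inter> fst c))"
proof -
  have "V \<subseteq> (\<Union>c\<in>man_atlas M. fst c)"
    using manifold domain_subset unfolding smooth_manifold_def by blast
  then show ?thesis by blast
qed

lemma open_range: "open (\<psi> ` V)"
  unfolding image_eq_Union by (auto intro: open_image)

lemma chart_obtain:
  assumes "q \<in> V"
  obtains c where "c \<in> charts_at M q"
  using assms some_chart_in_charts_at[OF manifold] domain_subset by blast

lemma image_mem: "q \<in> V \<Longrightarrow> c \<in> charts_at M q \<Longrightarrow> \<psi> q \<in> \<psi> ` (V \<inter> fst c)"
  by (auto simp: charts_at_def)

lemma chart_image_mem: "q \<in> V \<Longrightarrow> c \<in> charts_at M q \<Longrightarrow> snd c q \<in> snd c ` (V \<inter> fst c)"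
  by (auto simp: charts_at_def)

lemma differentiable_inverse:
  "q \<in> V \<Longrightarrow> c \<in> charts_at M q \<Longrightarrow> (\<lambda>z. snd c (\<eta> z)) differentiable (at (\<psi> q))"
  by (rule smooth_on_imp_differentiable[OF smooth_inverse image_mem]) (auto simp: charts_at_def)

lemma differentiable_coords:
  "q \<in> V \<Longrightarrow> c \<in> charts_at M q \<Longrightarrow> (\<lambda>x. \<psi> (chart_inv c x)) differentiable (at (snd c q))"
  by (rule smooth_on_imp_differentiable[OF smooth_coords chart_image_mem]) (auto simp: charts_at_def)

lemma derivative_coords_inverse:
  assumes "q \<in> V" "c \<in> charts_at M q"
  shows "frechet_derivative (\<lambda>x. \<psi> (chart_inv c x)) (at (snd c q))
    (frechet_derivative (\<lambda>z. snd c (\<eta> z)) (at (\<psi> q)) k) = k"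
proof -
  have "frechet_derivative (\<lambda>z. \<psi> (chart_inv c (snd c (\<eta> z)))) (at (\<psi> q)) k
      = frechet_derivative (\<lambda>x. \<psi> (chart_inv c x)) (at (snd c (\<eta> (\<psi> q))))
        (frechet_derivative (\<lambda>z. snd c (\<eta> z)) (at (\<psi> q)) k)"
    using assms by (intro frechet_derivative_chain[of "\<lambda>x. \<psi> (chart_inv c x)"])
      (auto simp: inverse differentiable_coords differentiable_inverse)
  moreover have "frechet_derivative (\<lambda>z. \<psi> (chart_inv c (snd c (\<eta> z)))) (at (\<psi> q))
      = frechet_derivative (\<lambda>z. z) (at (\<psi> q))"
    using assms by (intro frechet_derivative_cong_open[OF open_image image_mem])
      (auto simp: inverse charts_at_def chart_inv_chart[OF manifold])
  ultimately show ?thesis using assms by (simp add: inverse)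
qed

lemma derivative_inverse_coords:
  assumes "q \<in> V" "c \<in> charts_at M q"
  shows "frechet_derivative (\<lambda>z. snd c (\<eta> z)) (at (\<psi> q))
    (frechet_derivative (\<lambda>x. \<psi> (chart_inv c x)) (at (snd c q)) v) = v"
proof -
  have c: "c \<in> man_atlas M" "q \<in> fst c" using assms by (auto simp: charts_at_def)
  have "frechet_derivative (\<lambda>x. snd c (\<eta> (\<psi> (chart_inv c x)))) (at (snd c q)) v
      = frechet_derivative (\<lambda>z. snd c (\<eta> z)) (at (\<psi> (chart_inv c (snd c q))))
        (frechet_derivative (\<lambda>x. \<psi> (chart_inv c x)) (at (snd c q)) v)"
    using assms c by (intro frechet_derivative_chain[of "\<lambda>z. snd c (\<eta> z)"])
      (auto simp: chart_inv_chart[OF manifold] differentiable_coords differentiable_inverse)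
  moreover have "frechet_derivative (\<lambda>x. snd c (\<eta> (\<psi> (chart_inv c x)))) (at (snd c q))
      = frechet_derivative (\<lambda>x. x) (at (snd c q))"
    using assms c
    by (intro frechet_derivative_cong_open[OF open_chart_image[OF manifold _ open_domain] chart_image_mem])
      (auto simp: inverse chart_inv_chart[OF manifold])
  ultimately show ?thesis using c by (simp add: chart_inv_chart[OF manifold])
qed

lemma derivative_transition:
  assumes "q \<in> V" "c \<in> charts_at M q" "d \<in> charts_at M q"
  shows "frechet_derivative (transition c d) (at (snd c q))
      (frechet_derivative (\<lambda>z. snd c (\<eta> z)) (at (\<psi> q)) k)
    = frechet_derivative (\<lambda>z. snd d (\<eta> z)) (at (\<psi> q)) k"
proof -
  have "frechet_derivative (\<lambda>z. transition c d (snd c (\<eta> z))) (at (\<psi> q)) k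
      = frechet_derivative (transition c d) (at (snd c (\<eta> (\<psi> q))))
        (frechet_derivative (\<lambda>z. snd c (\<eta> z)) (at (\<psi> q)) k)"
    using assms by (intro frechet_derivative_chain[of "transition c d"])
      (auto simp: inverse differentiable_inverse intro: transition_differentiable[OF manifold])
  moreover have "frechet_derivative (\<lambda>z. transition c d (snd c (\<eta> z))) (at (\<psi> q))
      = frechet_derivative (\<lambda>z. snd d (\<eta> z)) (at (\<psi> q))"
  proof (rule frechet_derivative_cong_open)
    show "open (\<psi> ` (V \<inter> fst c))" "\<psi> q \<in> \<psi> ` (V \<inter> fst c)"
      using assms by (auto simp: charts_at_def intro: open_image)
  qed (use assms in \<open>auto simp: charts_at_def inverse transition_def chart_inv_chart[OF manifold]\<close>)
  ultimately show ?thesis using assms by (simp add: inverse)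
qed

lemma coord_vec_in_tangent_space: "q \<in> V \<Longrightarrow> coord_vec q k \<in> tangent_space M q"
  unfolding tangent_space_def by (auto simp: coord_vec_def derivative_transition)

lemma coord_comp_eq:
  assumes "q \<in> V" "v \<in> tangent_space M q" "c \<in> charts_at M q"
  shows "coord_comp q v = frechet_derivative (\<lambda>x. \<psi> (chart_inv c x)) (at (snd c q)) (v c)"
proof -
  define d where "d = some_chart M q"
  have d: "d \<in> charts_at M q"
    unfolding d_def using assms domain_subset by (auto intro!: some_chart_in_charts_at[OF manifold])
  define k where "k = frechet_derivative (\<lambda>x. \<psi> (chart_inv d x)) (at (snd d q)) (v d)"
  have "v c = frechet_derivative (transition d c) (at (snd d q)) (v d)"
    using assms d unfolding tangent_space_def by blast
  also have "v d = frechet_derivative (\<lambda>z. snd d (\<eta> z)) (at (\<psi> q)) k"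
    unfolding k_def by (rule derivative_inverse_coords[OF assms(1) d, symmetric])
  finally have "v c = frechet_derivative (\<lambda>z. snd c (\<eta> z)) (at (\<psi> q)) k"
    using derivative_transition[OF assms(1) d assms(3)] by simp
  then show ?thesis
    using derivative_coords_inverse[OF assms(1,3)] by (simp add: coord_comp_def k_def d_def Let_def)
qed

lemma coord_vec_coord_comp:
  assumes "q \<in> V" "v \<in> tangent_space M q"
  shows "coord_vec q (coord_comp q v) = v"
proof
  fix c
  show "coord_vec q (coord_comp q v) c = v c"
  proof (cases "c \<in> charts_at M q")
    case True
    then show ?thesis
      by (simp add: coord_vec_def coord_comp_eq[OF assms True] derivative_inverse_coords[OF assms(1) True])
  next
    case False
    then show ?thesis using assms(2) unfolding coord_vec_def tangent_space_def
      by (simp del: split_paired_All)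
  qed
qed

lemma coord_comp_coord_vec:
  assumes "q \<in> V"
  shows "coord_comp q (coord_vec q k) = k"
proof -
  obtain c where c: "c \<in> charts_at M q" using assms by (rule chart_obtain)
  show ?thesis
    unfolding coord_comp_eq[OF assms coord_vec_in_tangent_space[OF assms] c]
    using c by (simp add: coord_vec_def derivative_coords_inverse[OF assms c])
qed

lemma dim_coords_le:
  assumes "q \<in> V"
  shows "DIM('k) \<le> DIM('e)"
proof -
  obtain c where c: "c \<in> charts_at M q" using assms by (rule chart_obtain)
  let ?A = "frechet_derivative (\<lambda>x. \<psi> (chart_inv c x)) (at (snd c q))"
  have "linear ?A" by (rule linear_frechet_derivative[OF differentiable_coords[OF assms c]])
  moreover have "range ?A = UNIV"
    by (rule surjI) (rule derivative_coords_inverse[OF assms c])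
  ultimately show ?thesis using dim_image_le[of ?A UNIV] by (simp add: dim_UNIV)
qed

lemma linear_coord_vec: "q \<in> V \<Longrightarrow> linear (\<lambda>k. coord_vec q k c)"
  using linear_frechet_derivative[OF differentiable_inverse, of q c]
  by (cases "c \<in> charts_at M q") (auto simp: coord_vec_def module_hom_zero)

lemma coord_vec_add: "q \<in> V \<Longrightarrow> coord_vec q (k + l) c = coord_vec q k c + coord_vec q l c"
  by (rule linear_add[OF linear_coord_vec])

lemma coord_vec_diff: "q \<in> V \<Longrightarrow> coord_vec q (k - l) c = coord_vec q k c - coord_vec q l c"
  by (rule linear_diff[OF linear_coord_vec])

lemma coord_vec_scaleR: "q \<in> V \<Longrightarrow> coord_vec q (a *\<^sub>R k) c = a *\<^sub>R coord_vec q k c"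
  by (rule linear_cmul[OF linear_coord_vec])

lemma coord_vec_zero: "q \<in> V \<Longrightarrow> coord_vec q 0 c = 0"
  by (rule linear_0[OF linear_coord_vec])

lemma smooth_vfield_coord_field:
  assumes "smooth_on (\<psi> ` V) Y"
  shows "smooth_vfield M V (coord_field Y)"
  unfolding smooth_vfield_def
proof (intro conjI ballI)
  fix c assume c: "c \<in> man_atlas M"
  have o: "open (snd c ` (V \<inter> fst c))" by (rule open_chart_image[OF manifold c open_domain])
  have "smooth_on (snd c ` (V \<inter> fst c))
      (\<lambda>x. (\<lambda>z. frechet_derivative (\<lambda>z. snd c (\<eta> z)) (at z) (Y z)) (\<psi> (chart_inv c x)))"
  proof (rule smooth_on_compose[OF o open_image[OF c]])
    show "smooth_on (\<psi> ` (V \<inter> fst c)) (\<lambda>z. frechet_derivative (\<lambda>z. snd c (\<eta> z)) (at z) (Y z))"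
      by (intro smooth_on_apply_derivative open_image smooth_inverse c smooth_on_subset[OF assms]) auto
  qed (use c in \<open>auto simp: chart_inv_chart[OF manifold] intro: smooth_coords\<close>)
  then have "smooth_on (snd c ` (V \<inter> fst c)) (\<lambda>x. coord_field Y (chart_inv c x) c)"
    by (rule smooth_on_cong[OF o, rotated])
      (use c in \<open>auto simp: chart_inv_chart[OF manifold] coord_field_def coord_vec_def charts_at_def\<close>)
  then show "smooth_on (snd c ` (fst c \<inter> V)) (\<lambda>x. coord_field Y (chart_inv c x) c)"
    by (simp add: Int_commute)
qed (simp add: coord_field_def coord_vec_in_tangent_space)

text \<open>The chart selected in the definition of \<open>coord_comp\<close> may vary wildly with the point, but the result
  does not depend on it. Near a given point one fixed chart can be used instead.\<close>

lemma smooth_on_coord_rep: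
  assumes X: "smooth_vfield M V X"
  shows "smooth_on (\<psi> ` V) (coord_rep X)"
proof (rule smooth_on_local)
  fix z assume "z \<in> \<psi> ` V"
  then obtain q where q: "q \<in> V" "z = \<psi> q" by auto
  obtain c where "c \<in> charts_at M q" using q(1) by (rule chart_obtain)
  then have c: "c \<in> man_atlas M" "q \<in> fst c" by (auto simp: charts_at_def)
  have o: "open (snd c ` (V \<inter> fst c))" by (rule open_chart_image[OF manifold c(1) open_domain])
  have "smooth_on (\<psi> ` (V \<inter> fst c)) (\<lambda>z. (\<lambda>x. frechet_derivative (\<lambda>x. \<psi> (chart_inv c x)) (at x)
      (X (chart_inv c x) c)) (snd c (\<eta> z)))"
  proof (rule smooth_on_compose[OF open_image[OF c(1)] o])
    have "smooth_on (snd c ` (V \<inter> fst c)) (\<lambda>x. X (chart_inv c x) c)"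
      using X c(1) by (simp add: smooth_vfield_def Int_commute)
    then show "smooth_on (snd c ` (V \<inter> fst c))
        (\<lambda>x. frechet_derivative (\<lambda>x. \<psi> (chart_inv c x)) (at x) (X (chart_inv c x) c))"
      by (intro smooth_on_apply_derivative o smooth_coords c)
  qed (use c in \<open>auto simp: inverse intro: smooth_inverse\<close>)
  then have "smooth_on (\<psi> ` (V \<inter> fst c)) (coord_rep X)"
  proof (rule smooth_on_cong[OF open_image[OF c(1)], rotated])
    fix z assume "z \<in> \<psi> ` (V \<inter> fst c)"
    then obtain r where r: "z = \<psi> r" "r \<in> V" "r \<in> fst c" by auto
    then show "frechet_derivative (\<lambda>x. \<psi> (chart_inv c x)) (at (snd c (\<eta> z)))
        (X (chart_inv c (snd c (\<eta> z))) c) = coord_rep X z"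
      using X c coord_comp_eq[of r "X r" c]
      by (auto simp: coord_rep_def inverse chart_inv_chart[OF manifold] smooth_vfield_def charts_at_def)
  qed
  then show "\<exists>T. open T \<and> z \<in> T \<and> smooth_on T (coord_rep X)"
    using open_image[OF c(1)] q c by blast
qed

lemma coord_field_coord_rep:
  "smooth_vfield M V X \<Longrightarrow> q \<in> V \<Longrightarrow> coord_field (coord_rep X) q = X q"
  by (simp add: coord_field_def coord_rep_def inverse coord_vec_coord_comp smooth_vfield_def)

lemma smooth_function_coords:
  assumes "smooth_on (\<psi> ` V) f"
  shows "smooth_function M V (\<lambda>q. f (\<psi> q))"
  unfolding smooth_function_def
proof
  fix c assume c: "c \<in> man_atlas M"
  have "smooth_on (snd c ` (V \<inter> fst c)) (\<lambda>x. f (\<psi> (chart_inv c x)))"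
  proof (rule smooth_on_compose[OF open_chart_image[OF manifold c open_domain] open_range])
    show "(\<lambda>x. \<psi> (chart_inv c x)) ` snd c ` (V \<inter> fst c) \<subseteq> \<psi> ` V"
      using c by (auto simp: chart_inv_chart[OF manifold])
  qed (use c assms smooth_coords in auto)
  then show "smooth_on (snd c ` (fst c \<inter> V)) ((\<lambda>q. f (\<psi> q)) \<circ> chart_inv c)"
    by (simp add: Int_commute comp_def)
qed

lemma smooth_function_chartD:
  "smooth_function M V f \<Longrightarrow> c \<in> man_atlas M \<Longrightarrow>
    smooth_on (snd c ` (V \<inter> fst c)) (\<lambda>x. f (chart_inv c x))"
  by (simp add: smooth_function_def comp_def Int_commute)

lemma smooth_on_smooth_function:
  assumes "smooth_function M V f"
  shows "smooth_on (\<psi> ` V) (\<lambda>z. f (\<eta> z))"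
proof (rule smooth_on_local)
  fix z assume "z \<in> \<psi> ` V"
  then obtain q where q: "q \<in> V" "z = \<psi> q" by auto
  obtain c where "c \<in> charts_at M q" using q(1) by (rule chart_obtain)
  then have c: "c \<in> man_atlas M" "q \<in> fst c" by (auto simp: charts_at_def)
  have "smooth_on (\<psi> ` (V \<inter> fst c)) (\<lambda>z. (\<lambda>x. f (chart_inv c x)) (snd c (\<eta> z)))"
    by (rule smooth_on_compose[OF open_image[OF c(1)] open_chart_image[OF manifold c(1) open_domain]])
      (use c assms in \<open>auto simp: inverse intro: smooth_inverse smooth_function_chartD\<close>)
  then have "smooth_on (\<psi> ` (V \<inter> fst c)) (\<lambda>z. f (\<eta> z))"
    by (rule smooth_on_cong[OF open_image[OF c(1)], rotated])
      (use c in \<open>auto simp: inverse chart_inv_chart[OF manifold]\<close>)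
  then show "\<exists>T. open T \<and> z \<in> T \<and> smooth_on T (\<lambda>z. f (\<eta> z))"
    using open_image[OF c(1)] q c by blast
qed

lemma dir_deriv_coord_vec:
  assumes "q \<in> V" "smooth_function M V f"
  shows "dir_deriv M q (coord_vec q k) f = frechet_derivative (\<lambda>z. f (\<eta> z)) (at (\<psi> q)) k"
proof -
  define c where "c = some_chart M q"
  have c: "c \<in> charts_at M q"
    unfolding c_def using assms domain_subset by (auto intro!: some_chart_in_charts_at[OF manifold])
  have "(\<lambda>x. f (chart_inv c x)) differentiable (at (snd c q))"
    using smooth_on_imp_differentiable[OF smooth_function_chartD[OF assms(2) charts_atD(1)[OF c]]
        chart_image_mem[OF assms(1) c]] .
  then have "frechet_derivative (\<lambda>z. f (chart_inv c (snd c (\<eta> z)))) (at (\<psi> q)) k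
      = frechet_derivative (\<lambda>x. f (chart_inv c x)) (at (snd c (\<eta> (\<psi> q))))
        (frechet_derivative (\<lambda>z. snd c (\<eta> z)) (at (\<psi> q)) k)"
    using assms c by (intro frechet_derivative_chain[of "\<lambda>x. f (chart_inv c x)"])
      (auto simp: inverse differentiable_inverse)
  moreover have "frechet_derivative (\<lambda>z. f (chart_inv c (snd c (\<eta> z)))) (at (\<psi> q))
      = frechet_derivative (\<lambda>z. f (\<eta> z)) (at (\<psi> q))"
    using assms c by (intro frechet_derivative_cong_open[OF open_image image_mem])
      (auto simp: inverse charts_at_def chart_inv_chart[OF manifold])
  ultimately show ?thesis
    using assms c by (simp add: dir_deriv_def c_def[symmetric] coord_vec_def comp_def inverse)
qed

text \<open>In a chart \<open>c\<close> the field \<open>\<partial>\<^sub>v\<close> is \<open>z \<mapsto> D\<phi>(z) v\<close> with \<open>\<phi> = c \<circ> \<eta>\<close>, so the bracket of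
  \<open>\<partial>\<^sub>u\<close> and \<open>\<partial>\<^sub>v\<close> is the antisymmetric part of \<open>D\<^sup>2\<phi>\<close>.\<close>

lemma lie_bracket_coord_fields:
  assumes "q \<in> V"
  shows "lie_bracket M (coord_field (\<lambda>z. u)) (coord_field (\<lambda>z. v)) q = (\<lambda>c. 0)"
proof
  fix c
  show "lie_bracket M (coord_field (\<lambda>z. u)) (coord_field (\<lambda>z. v)) q c = 0"
  proof (cases "c \<in> charts_at M q")
    case True
    note c = charts_atD[OF True]
    let ?\<phi> = "\<lambda>z. snd c (\<eta> z)"
    have main: "frechet_derivative (\<lambda>x. coord_field (\<lambda>z. v) (chart_inv c x) c) (at (snd c q))
          (coord_field (\<lambda>z. u) q c)
        = frechet_derivative (\<lambda>z. frechet_derivative ?\<phi> (at z) v) (at (\<psi> q)) u" for u v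
    proof -
      have "frechet_derivative (\<lambda>x. coord_field (\<lambda>z. v) (chart_inv c x) c) (at (snd c q))
          = frechet_derivative (\<lambda>x. (\<lambda>z. frechet_derivative ?\<phi> (at z) v) (\<psi> (chart_inv c x))) (at (snd c q))"
        using assms c
        by (intro frechet_derivative_cong_open[OF open_chart_image[OF manifold _ open_domain] chart_image_mem[OF assms True]])
          (auto simp: chart_inv_chart[OF manifold] coord_field_def coord_vec_def charts_at_def)
      moreover have "frechet_derivative (\<lambda>x. (\<lambda>z. frechet_derivative ?\<phi> (at z) v) (\<psi> (chart_inv c x))) (at (snd c q)) w
          = frechet_derivative (\<lambda>z. frechet_derivative ?\<phi> (at z) v) (at (\<psi> (chart_inv c (snd c q))))
            (frechet_derivative (\<lambda>x. \<psi> (chart_inv c x)) (at (snd c q)) w)" for w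
      proof (rule frechet_derivative_chain)
        show "(\<lambda>z. frechet_derivative ?\<phi> (at z) v) differentiable at (\<psi> (chart_inv c (snd c q)))"
          using smooth_on_imp_differentiable[OF smooth_on_dir_derivative[OF smooth_inverse[OF c(1)]]
              image_mem[OF assms True]] c by (simp add: chart_inv_chart[OF manifold])
      qed (rule differentiable_coords[OF assms True])
      ultimately show ?thesis
        using c True by (simp add: chart_inv_chart[OF manifold] coord_field_def coord_vec_def
            derivative_coords_inverse[OF assms True])
    qed
    show ?thesis
      using True main symmetric_second_derivative[OF open_image[OF c(1)] image_mem[OF assms True]
          smooth_inverse[OF c(1)], of u v]
      by (simp add: lie_bracket_def)
  qed (simp add: lie_bracket_def)
qed

text \<open>Vector fields that are smooth near a point have different domains of smoothness; shrinking the
  coordinate domain brings them all to a common one.\<close>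

lemma coordinates_restrict:
  assumes "open_in M V'" "V' \<subseteq> V"
  shows "coordinates M V' \<psi> \<eta>"
proof
  fix c assume c: "c \<in> man_atlas M"
  have "\<psi> ` (V' \<inter> fst c) = (\<lambda>z. snd c (\<eta> z)) -` (snd c ` (V' \<inter> fst c)) \<inter> \<psi> ` (V \<inter> fst c)"
    using assms(2) inj_onD[OF inj_on_chart[OF manifold c]]
    by (auto simp: inverse subset_iff) (metis (no_types, lifting) IntI image_eqI)
  then show "open (\<psi> ` (V' \<inter> fst c))"
    using continuous_open_vimage open_chart_image[OF manifold c assms(1)] open_image[OF c]
      smooth_on_imp_continuous_on[OF smooth_inverse[OF c]]
    by (metis continuous_on_open_vimage)
  show "smooth_on (\<psi> ` (V' \<inter> fst c)) (\<lambda>z. snd c (\<eta> z))"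
    by (rule smooth_on_subset[OF smooth_inverse[OF c]]) (use assms in auto)
  show "smooth_on (snd c ` (V' \<inter> fst c)) (\<lambda>x. \<psi> (chart_inv c x))"
    by (rule smooth_on_subset[OF smooth_coords[OF c]]) (use assms in auto)
qed (use assms manifold inverse in auto)

end


section \<open>Connections in coordinates\<close>

lemma affine_connection_rules:
  assumes "affine_connection M D" "open_in M U" "smooth_vfield M U X" "smooth_vfield M U Y"
  shows smooth_vfield_connection: "smooth_vfield M U (D X Y)"
    and connection_add_left: "smooth_vfield M U Z \<Longrightarrow> p \<in> U \<Longrightarrow>
      D (\<lambda>q c. X q c + Y q c) Z p = (\<lambda>c. D X Z p c + D Y Z p c)"
    and connection_add_right: "smooth_vfield M U Z \<Longrightarrow> p \<in> U \<Longrightarrow>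
      D X (\<lambda>q c. Y q c + Z q c) p = (\<lambda>c. D X Y p c + D X Z p c)"
    and connection_scale_left: "smooth_function M U f \<Longrightarrow> p \<in> U \<Longrightarrow>
      D (\<lambda>q c. f q *\<^sub>R X q c) Y p = (\<lambda>c. f p *\<^sub>R D X Y p c)"
    and connection_scale_right: "smooth_function M U f \<Longrightarrow> p \<in> U \<Longrightarrow>
      D X (\<lambda>q c. f q *\<^sub>R Y q c) p = (\<lambda>c. dir_deriv M p (X p) f *\<^sub>R Y p c + f p *\<^sub>R D X Y p c)"
  using assms smooth_function_const[of M U 0] unfolding affine_connection_def by blast+

locale connection_in_coordinates = coordinates M V \<psi> \<eta>
  for M :: "('p, 'e::euclidean_space, 'm) manifold_scheme"
    and V :: "'p set" and \<psi> :: "'p \<Rightarrow> 'k::euclidean_space" and \<eta> :: "'k \<Rightarrow> 'p" +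
  fixes D :: "('p, 'e) vfield \<Rightarrow> ('p, 'e) vfield \<Rightarrow> ('p, 'e) vfield"
  assumes affine: "affine_connection M D"
    and torsion: "torsion_free M D"
begin

lemma smooth_vfield_zero_on:
  assumes "\<And>q. q \<in> V \<Longrightarrow> Z q = (\<lambda>c. 0)"
  shows "smooth_vfield M V Z"
  using manifold open_domain smooth_vfield_coord_field[OF smooth_on_const[of _ 0]]
proof (rule smooth_vfield_cong)
  show "coord_field (\<lambda>z. 0) q = Z q" if "q \<in> V" for q
    using assms[OF that] that by (simp add: coord_field_def coord_vec_zero fun_eq_iff)
qed

text \<open>If two fields agree on \<open>V\<close>, then their difference \<open>Z\<close> satisfies \<open>Z = f Z\<close>, where \<open>f\<close> is \<open>0\<close> on \<open>V\<close> and
  \<open>1\<close> elsewhere. Since \<open>f\<close> is smooth on the open set \<open>V\<close>, the rules for multiples by functions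
  give locality at once.\<close>

lemma connection_local:
  assumes X: "smooth_vfield M V X" "\<And>q. q \<in> V \<Longrightarrow> X q = X' q"
    and Y: "smooth_vfield M V Y" "\<And>q. q \<in> V \<Longrightarrow> Y q = Y' q" and p: "p \<in> V"
  shows "D X Y p = D X' Y' p"
proof -
  define f :: "'p \<Rightarrow> real" where "f q = (if q \<in> V then 0 else 1)" for q
  have f: "smooth_function M V f"
    by (rule smooth_function_cong[OF manifold open_domain smooth_function_const[of _ _ 0]])
      (simp add: f_def)
  note rules = affine_connection_rules[OF affine open_domain]
  have "D X' Y p = D X Y p"
  proof -
    define Z where "Z q c = X' q c - X q c" for q c
    have Z0: "Z q = (\<lambda>c. 0)" if "q \<in> V" for q using X(2)[OF that] by (simp add: Z_def fun_eq_iff)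
    then have Z: "smooth_vfield M V Z" by (rule smooth_vfield_zero_on)
    have "(\<lambda>q c. f q *\<^sub>R Z q c) = Z" using Z0 by (auto simp: f_def fun_eq_iff)
    then have "D Z Y p = (\<lambda>c. 0)" using rules(4)[OF Z Y(1) f p] p by (simp add: f_def)
    moreover have "(\<lambda>q c. X q c + Z q c) = X'" by (simp add: Z_def)
    ultimately show ?thesis using rules(2)[OF X(1) Z Y(1) p] by simp
  qed
  moreover have "D X' Y' p = D X' Y p"
  proof -
    have X': "smooth_vfield M V X'" using smooth_vfield_cong[OF manifold open_domain X] .
    define Z where "Z q c = Y' q c - Y q c" for q c
    have Z0: "Z q = (\<lambda>c. 0)" if "q \<in> V" for q using Y(2)[OF that] by (simp add: Z_def fun_eq_iff)
    then have Z: "smooth_vfield M V Z" by (rule smooth_vfield_zero_on)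
    have "(\<lambda>q c. f q *\<^sub>R Z q c) = Z" using Z0 by (auto simp: f_def fun_eq_iff)
    then have "D X' Z p = (\<lambda>c. 0)" using rules(5)[OF X' Z f p] p Z0[OF p] by (simp add: f_def)
    moreover have "(\<lambda>q c. Y q c + Z q c) = Y'" by (simp add: Z_def)
    ultimately show ?thesis using rules(3)[OF X' Y(1) Z p] by simp
  qed
  ultimately show ?thesis by simp
qed

definition nabla :: "('k \<Rightarrow> 'k) \<Rightarrow> ('k \<Rightarrow> 'k) \<Rightarrow> 'k \<Rightarrow> 'k" where
  "nabla X Y = coord_rep (D (coord_field X) (coord_field Y))"

lemma smooth_on_nabla:
  "smooth_on (\<psi> ` V) X \<Longrightarrow> smooth_on (\<psi> ` V) Y \<Longrightarrow> smooth_on (\<psi> ` V) (nabla X Y)"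
  unfolding nabla_def
  by (intro smooth_on_coord_rep smooth_vfield_connection[OF affine open_domain] smooth_vfield_coord_field)

lemma connection_eq_nabla:
  assumes "smooth_vfield M V X" "smooth_vfield M V Y" "q \<in> V"
  shows "D X Y q = coord_field (nabla (coord_rep X) (coord_rep Y)) q"
proof -
  note s = smooth_vfield_coord_field[OF smooth_on_coord_rep]
  have "D X Y q = D (coord_field (coord_rep X)) (coord_field (coord_rep Y)) q"
    using assms coord_field_coord_rep by (intro connection_local) auto
  then show ?thesis
    unfolding nabla_def using assms
    by (simp add: coord_field_coord_rep smooth_vfield_connection[OF affine open_domain] s)
qed

lemma coord_field_cong: "(\<And>z. z \<in> \<psi> ` V \<Longrightarrow> X z = Y z) \<Longrightarrow> q \<in> V \<Longrightarrow> coord_field X q = coord_field Y q"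
  by (simp add: coord_field_def)

lemma nabla_cong:
  assumes "smooth_on (\<psi> ` V) X" "smooth_on (\<psi> ` V) Y" "z \<in> \<psi> ` V"
    "\<And>z. z \<in> \<psi> ` V \<Longrightarrow> X z = X' z" "\<And>z. z \<in> \<psi> ` V \<Longrightarrow> Y z = Y' z"
  shows "nabla X Y z = nabla X' Y' z"
proof -
  obtain q where q: "q \<in> V" "z = \<psi> q" using assms by auto
  have "D (coord_field X) (coord_field Y) q = D (coord_field X') (coord_field Y') q"
    by (rule connection_local) (use assms q in \<open>auto intro!: smooth_vfield_coord_field coord_field_cong\<close>)
  then show ?thesis using q by (simp add: nabla_def coord_rep_def inverse)
qed

lemma nablaI:
  assumes "q \<in> V" "D (coord_field X) (coord_field Y) q = coord_vec q k"
  shows "nabla X Y (\<psi> q) = k"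
  using assms by (simp add: nabla_def coord_rep_def inverse coord_comp_coord_vec)

lemma connection_coord_field:
  assumes "smooth_on (\<psi> ` V) X" "smooth_on (\<psi> ` V) Y" "q \<in> V"
  shows "D (coord_field X) (coord_field Y) q = coord_vec q (nabla X Y (\<psi> q))"
  using coord_field_coord_rep[OF smooth_vfield_connection[OF affine open_domain
      smooth_vfield_coord_field[OF assms(1)] smooth_vfield_coord_field[OF assms(2)]] assms(3)]
  by (simp add: nabla_def coord_field_def)

lemma nabla_rules:
  assumes X: "smooth_on (\<psi> ` V) X" and Y: "smooth_on (\<psi> ` V) Y" and z: "z \<in> \<psi> ` V"
  shows nabla_add_left: "smooth_on (\<psi> ` V) Z \<Longrightarrow> nabla (\<lambda>z. X z + Y z) Z z = nabla X Z z + nabla Y Z z"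
    and nabla_add_right: "smooth_on (\<psi> ` V) Z \<Longrightarrow> nabla X (\<lambda>z. Y z + Z z) z = nabla X Y z + nabla X Z z"
    and nabla_scale_left: "smooth_on (\<psi> ` V) f \<Longrightarrow> nabla (\<lambda>z. f z *\<^sub>R X z) Y z = f z *\<^sub>R nabla X Y z"
    and nabla_scale_right: "smooth_on (\<psi> ` V) f \<Longrightarrow> nabla X (\<lambda>z. f z *\<^sub>R Y z) z
      = frechet_derivative f (at z) (X z) *\<^sub>R Y z + f z *\<^sub>R nabla X Y z"
proof -
  obtain q where q: "q \<in> V" "z = \<psi> q" using z by auto
  note s = smooth_vfield_coord_field and o = open_range
  note rules = affine_connection_rules[OF affine open_domain]
  have add: "coord_field (\<lambda>z. X z + Y z) r = (\<lambda>c. coord_field X r c + coord_field Y r c)"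
    if "r \<in> V" for r X Y using that by (simp add: coord_field_def coord_vec_add fun_eq_iff)
  have scale: "coord_field (\<lambda>z. f z *\<^sub>R X z) r = (\<lambda>c. f (\<psi> r) *\<^sub>R coord_field X r c)"
    if "r \<in> V" for r f X using that by (simp add: coord_field_def coord_vec_scaleR fun_eq_iff)
  show "nabla (\<lambda>z. X z + Y z) Z z = nabla X Z z + nabla Y Z z" if Z: "smooth_on (\<psi> ` V) Z"
    unfolding q(2)
  proof (rule nablaI[OF q(1)])
    have "D (coord_field (\<lambda>z. X z + Y z)) (coord_field Z) q
        = D (\<lambda>r c. coord_field X r c + coord_field Y r c) (coord_field Z) q"
      by (rule connection_local[OF s _ s[OF Z] _ q(1)]) (simp_all add: add smooth_on_add[OF o X Y])
    then show "D (coord_field (\<lambda>z. X z + Y z)) (coord_field Z) q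
        = coord_vec q (nabla X Z (\<psi> q) + nabla Y Z (\<psi> q))"
      by (simp add: rules(2)[OF s[OF X] s[OF Y] s[OF Z] q(1)] connection_coord_field X Y Z q
          coord_vec_add fun_eq_iff)
  qed
  show "nabla X (\<lambda>z. Y z + Z z) z = nabla X Y z + nabla X Z z" if Z: "smooth_on (\<psi> ` V) Z"
    unfolding q(2)
  proof (rule nablaI[OF q(1)])
    have "D (coord_field X) (coord_field (\<lambda>z. Y z + Z z)) q
        = D (coord_field X) (\<lambda>r c. coord_field Y r c + coord_field Z r c) q"
      by (rule connection_local[OF s[OF X] _ s _ q(1)]) (simp_all add: add smooth_on_add[OF o Y Z])
    then show "D (coord_field X) (coord_field (\<lambda>z. Y z + Z z)) q
        = coord_vec q (nabla X Y (\<psi> q) + nabla X Z (\<psi> q))"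
      by (simp add: rules(3)[OF s[OF X] s[OF Y] s[OF Z] q(1)] connection_coord_field X Y Z q
          coord_vec_add fun_eq_iff)
  qed
  show "nabla (\<lambda>z. f z *\<^sub>R X z) Y z = f z *\<^sub>R nabla X Y z" if f: "smooth_on (\<psi> ` V) f"
    unfolding q(2)
  proof (rule nablaI[OF q(1)])
    have "D (coord_field (\<lambda>z. f z *\<^sub>R X z)) (coord_field Y) q
        = D (\<lambda>r c. f (\<psi> r) *\<^sub>R coord_field X r c) (coord_field Y) q"
      by (rule connection_local[OF s _ s[OF Y] _ q(1)]) (simp_all add: scale smooth_on_scaleR[OF o f X])
    then show "D (coord_field (\<lambda>z. f z *\<^sub>R X z)) (coord_field Y) q
        = coord_vec q (f (\<psi> q) *\<^sub>R nabla X Y (\<psi> q))"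
      by (simp add: rules(4)[OF s[OF X] s[OF Y] smooth_function_coords[OF f] q(1)]
          connection_coord_field X Y q coord_vec_scaleR fun_eq_iff)
  qed
  show "nabla X (\<lambda>z. f z *\<^sub>R Y z) z
      = frechet_derivative f (at z) (X z) *\<^sub>R Y z + f z *\<^sub>R nabla X Y z" if f: "smooth_on (\<psi> ` V) f"
    unfolding q(2)
  proof (rule nablaI[OF q(1)])
    have "D (coord_field X) (coord_field (\<lambda>z. f z *\<^sub>R Y z)) q
        = D (coord_field X) (\<lambda>r c. f (\<psi> r) *\<^sub>R coord_field Y r c) q"
      by (rule connection_local[OF s[OF X] _ s _ q(1)]) (simp_all add: scale smooth_on_scaleR[OF o f Y])
    moreover have "dir_deriv M q (coord_field X q) (\<lambda>r. f (\<psi> r)) = frechet_derivative f (at (\<psi> q)) (X (\<psi> q))"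
    proof -
      have "frechet_derivative (\<lambda>z. f (\<psi> (\<eta> z))) (at (\<psi> q)) = frechet_derivative f (at (\<psi> q))"
        by (rule frechet_derivative_cong_open[OF o]) (use q in \<open>auto simp: inverse\<close>)
      then show ?thesis
        using dir_deriv_coord_vec[OF q(1) smooth_function_coords[OF f]] by (simp add: coord_field_def)
    qed
    ultimately show "D (coord_field X) (coord_field (\<lambda>z. f z *\<^sub>R Y z)) q
        = coord_vec q (frechet_derivative f (at (\<psi> q)) (X (\<psi> q)) *\<^sub>R Y (\<psi> q) + f (\<psi> q) *\<^sub>R nabla X Y (\<psi> q))"
      by (simp add: rules(5)[OF s[OF X] s[OF Y] smooth_function_coords[OF f] q(1)]
          connection_coord_field X Y q coord_vec_scaleR coord_vec_add fun_eq_iff)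
        (simp add: coord_field_def)
  qed
qed

lemma nabla_zero:
  assumes "smooth_on (\<psi> ` V) Y" "z \<in> \<psi> ` V"
  shows "nabla (\<lambda>z. 0) Y z = 0" "nabla Y (\<lambda>z. 0) z = 0"
  using nabla_add_left[OF smooth_on_const[of _ 0] smooth_on_const[of _ 0] assms(2,1)]
    nabla_add_right[OF assms(1) smooth_on_const[of _ 0] assms(2) smooth_on_const[of _ 0]] by auto

lemma nabla_sum_left:
  assumes "finite I" "\<And>i. i \<in> I \<Longrightarrow> smooth_on (\<psi> ` V) (X i)" "smooth_on (\<psi> ` V) Y" "z \<in> \<psi> ` V"
  shows "nabla (\<lambda>z. \<Sum>i\<in>I. X i z) Y z = (\<Sum>i\<in>I. nabla (X i) Y z)"
  using assms(1,2)
  by induction (simp_all add: nabla_zero assms nabla_add_left smooth_on_sum open_range)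

lemma nabla_sum_right:
  assumes "finite I" "\<And>i. i \<in> I \<Longrightarrow> smooth_on (\<psi> ` V) (X i)" "smooth_on (\<psi> ` V) Y" "z \<in> \<psi> ` V"
  shows "nabla Y (\<lambda>z. \<Sum>i\<in>I. X i z) z = (\<Sum>i\<in>I. nabla Y (X i) z)"
  using assms(1,2)
  by induction (simp_all add: nabla_zero assms nabla_add_right smooth_on_sum open_range)

text \<open>The Christoffel symbols are extended bilinearly from the basis, which makes them bilinear
  by construction; that they describe the connection on arbitrary fields is \<open>nabla_eq_christoffel\<close>.\<close>

definition christoffel :: "'k \<Rightarrow> 'k \<Rightarrow> 'k \<Rightarrow> 'k" where
  "christoffel z u v = (\<Sum>b\<in>Basis. \<Sum>b'\<in>Basis. ((u \<bullet> b) * (v \<bullet> b')) *\<^sub>R nabla (\<lambda>z. b) (\<lambda>z. b') z)"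

lemma bilinear_christoffel: "bilinear (christoffel z)"
  unfolding bilinear_def christoffel_def
  by (auto intro!: linearI simp: inner_add_left algebra_simps sum.distrib scaleR_sum_right)

text \<open>Expanding both fields in the constant fields of a basis reduces this to linearity over functions in
  the first argument and to the Leibniz rule in the second.\<close>

lemma nabla_eq_christoffel:
  assumes X: "smooth_on (\<psi> ` V) X" and Y: "smooth_on (\<psi> ` V) Y" and z: "z \<in> \<psi> ` V"
  shows "nabla X Y z = frechet_derivative Y (at z) (X z) + christoffel z (X z) (Y z)"
proof -
  note o = open_range and c = smooth_on_const
  have inner: "frechet_derivative (\<lambda>z. Y z \<bullet> b') (at z) b = frechet_derivative Y (at z) b \<bullet> b'" for b b'
    by (rule frechet_derivative_eqI, rule has_derivative_inner_left,
        rule smooth_on_imp_has_derivative[OF Y z])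
  have b: "nabla (\<lambda>z. b) Y z = frechet_derivative Y (at z) b
      + (\<Sum>b'\<in>Basis. (Y z \<bullet> b') *\<^sub>R nabla (\<lambda>z. b) (\<lambda>z. b') z)" for b
  proof -
    have "nabla (\<lambda>z. b) Y z = nabla (\<lambda>z. b) (\<lambda>z. \<Sum>b'\<in>Basis. (Y z \<bullet> b') *\<^sub>R b') z"
      by (simp add: euclidean_representation)
    also have "\<dots> = (\<Sum>b'\<in>Basis. nabla (\<lambda>z. b) (\<lambda>z. (Y z \<bullet> b') *\<^sub>R b') z)"
      by (rule nabla_sum_right) (auto intro!: smooth_on_scaleR smooth_on_inner o c Y z)
    also have "\<dots> = (\<Sum>b'\<in>Basis. (frechet_derivative Y (at z) b \<bullet> b') *\<^sub>R b'
        + (Y z \<bullet> b') *\<^sub>R nabla (\<lambda>z. b) (\<lambda>z. b') z)"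
      by (simp add: nabla_scale_right[OF c c z smooth_on_inner[OF o Y]] inner)
    finally show ?thesis by (simp add: sum.distrib euclidean_representation)
  qed
  have "nabla X Y z = nabla (\<lambda>z. \<Sum>b\<in>Basis. (X z \<bullet> b) *\<^sub>R b) Y z"
    by (simp add: euclidean_representation)
  also have "\<dots> = (\<Sum>b\<in>Basis. nabla (\<lambda>z. (X z \<bullet> b) *\<^sub>R b) Y z)"
    by (rule nabla_sum_left) (auto intro!: smooth_on_scaleR smooth_on_inner o c X Y z)
  also have "\<dots> = (\<Sum>b\<in>Basis. (X z \<bullet> b) *\<^sub>R nabla (\<lambda>z. b) Y z)"
    by (simp add: nabla_scale_left[OF c Y z smooth_on_inner[OF o X]])
  also have "\<dots> = frechet_derivative Y (at z) (X z) + christoffel z (X z) (Y z)"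
    by (simp add: b christoffel_def algebra_simps sum.distrib scaleR_sum_right
        frechet_derivative_expand_basis[OF smooth_on_imp_differentiable[OF Y z], of "X z"])
  finally show ?thesis .
qed

lemma christoffel_eq_nabla:
  "z \<in> \<psi> ` V \<Longrightarrow> christoffel z u v = nabla (\<lambda>z. u) (\<lambda>z. v) z"
  by (simp add: nabla_eq_christoffel smooth_on_const)

lemma lie_bracket_coord_field:
  assumes "smooth_on (\<psi> ` V) X" "smooth_on (\<psi> ` V) Y" "q \<in> V"
  shows "lie_bracket M (coord_field X) (coord_field Y) q = coord_vec q (nabla X Y (\<psi> q) - nabla Y X (\<psi> q))"
proof -
  have "lie_bracket M (coord_field X) (coord_field Y) q
      = (\<lambda>c. D (coord_field X) (coord_field Y) q c - D (coord_field Y) (coord_field X) q c)"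
    using torsion open_domain assms smooth_vfield_coord_field unfolding torsion_free_def by metis
  then show ?thesis using assms by (simp add: connection_coord_field coord_vec_diff fun_eq_iff)
qed

text \<open>The torsion vanishes and coordinate fields commute.\<close>

lemma christoffel_symmetric:
  assumes "z \<in> \<psi> ` V"
  shows "christoffel z u v = christoffel z v u"
proof -
  obtain q where q: "q \<in> V" "z = \<psi> q" using assms by auto
  have "coord_vec q (christoffel z u v - christoffel z v u) = (\<lambda>c. 0)"
    unfolding christoffel_eq_nabla[OF assms] unfolding q(2)
    using lie_bracket_coord_field[OF smooth_on_const smooth_on_const q(1), of u v]
      lie_bracket_coord_fields[OF q(1), of u v] by simp
  also have "\<dots> = coord_vec q 0" using coord_vec_zero[OF q(1)] by auto
  finally have "coord_comp q (coord_vec q (christoffel z u v - christoffel z v u)) = coord_comp q (coord_vec q 0)"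
    by simp
  then show ?thesis by (simp add: coord_comp_coord_vec[OF q(1)])
qed

definition christoffel_deriv :: "'k \<Rightarrow> 'k \<Rightarrow> 'k \<Rightarrow> 'k \<Rightarrow> 'k" where
  "christoffel_deriv z w u v = frechet_derivative (\<lambda>z. christoffel z u v) (at z) w"

lemma smooth_on_christoffel:
  assumes "smooth_on (\<psi> ` V) X" "smooth_on (\<psi> ` V) Y"
  shows "smooth_on (\<psi> ` V) (\<lambda>z. christoffel z (X z) (Y z))"
proof (rule smooth_on_cong[OF open_range])
  show "smooth_on (\<psi> ` V) (\<lambda>z. nabla X Y z - frechet_derivative Y (at z) (X z))"
    by (intro smooth_on_diff smooth_on_nabla smooth_on_apply_derivative open_range assms)
qed (simp add: nabla_eq_christoffel assms)

lemma christoffel_has_derivative: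
  assumes z: "z \<in> \<psi> ` V"
  shows "((\<lambda>z. christoffel z u v) has_derivative
    (\<lambda>w. \<Sum>b\<in>Basis. \<Sum>b'\<in>Basis. ((u \<bullet> b) * (v \<bullet> b')) *\<^sub>R
      frechet_derivative (nabla (\<lambda>z. b) (\<lambda>z. b')) (at z) w)) (at z)"
  unfolding christoffel_def
  by (intro has_derivative_sum has_derivative_scaleR_right smooth_on_imp_has_derivative[OF smooth_on_nabla z]
      smooth_on_const)

lemma christoffel_deriv_eq:
  assumes z: "z \<in> \<psi> ` V"
  shows "christoffel_deriv z w u v = (\<Sum>b\<in>Basis. \<Sum>b'\<in>Basis. ((u \<bullet> b) * (v \<bullet> b')) *\<^sub>R
      frechet_derivative (nabla (\<lambda>z. b) (\<lambda>z. b')) (at z) w)"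
  unfolding christoffel_deriv_def by (rule frechet_derivative_eqI[OF christoffel_has_derivative[OF z]])

lemma linear_christoffel_deriv:
  assumes z: "z \<in> \<psi> ` V"
  shows "linear (\<lambda>w. christoffel_deriv z w u v)" "bilinear (christoffel_deriv z w)"
proof -
  show "linear (\<lambda>w. christoffel_deriv z w u v)"
    unfolding christoffel_deriv_def
    using linear_frechet_derivative[OF differentiableI[OF christoffel_has_derivative[OF z]]] .
  show "bilinear (christoffel_deriv z w)"
    unfolding bilinear_def christoffel_deriv_eq[OF z]
    by (auto intro!: linearI simp: inner_add_left algebra_simps sum.distrib scaleR_sum_right)
qed

lemma derivative_christoffel_fields:
  assumes X: "smooth_on (\<psi> ` V) X" and Y: "smooth_on (\<psi> ` V) Y" and z: "z \<in> \<psi> ` V"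
  shows "frechet_derivative (\<lambda>z. christoffel z (X z) (Y z)) (at z) w
    = christoffel_deriv z w (X z) (Y z) + christoffel z (frechet_derivative X (at z) w) (Y z)
      + christoffel z (X z) (frechet_derivative Y (at z) w)"
proof -
  let ?N = "\<lambda>b b'. nabla (\<lambda>z. b) (\<lambda>z. b')"
  have N: "(?N b b' has_derivative frechet_derivative (?N b b') (at z)) (at z)" for b b'
    by (rule smooth_on_imp_has_derivative[OF smooth_on_nabla z]) (rule smooth_on_const)+
  note dX = smooth_on_imp_has_derivative[OF X z] and dY = smooth_on_imp_has_derivative[OF Y z]
  have "((\<lambda>z. christoffel z (X z) (Y z)) has_derivative
      (\<lambda>w. \<Sum>b\<in>Basis. \<Sum>b'\<in>Basis. ((X z \<bullet> b) * (Y z \<bullet> b')) *\<^sub>R frechet_derivative (?N b b') (at z) w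
        + ((X z \<bullet> b) * (frechet_derivative Y (at z) w \<bullet> b') + (frechet_derivative X (at z) w \<bullet> b) * (Y z \<bullet> b'))
          *\<^sub>R ?N b b' z)) (at z)"
    unfolding christoffel_def
    by (intro has_derivative_sum has_derivative_scaleR has_derivative_mult has_derivative_inner_left dX dY N)
  from frechet_derivative_eqI[OF this, of w] show ?thesis
    unfolding christoffel_deriv_eq[OF z]
    by (simp add: christoffel_def sum.distrib scaleR_add_left)
qed

lemma derivative_directional_derivative:
  assumes X: "smooth_on (\<psi> ` V) X" and Y: "smooth_on (\<psi> ` V) Y" and z: "z \<in> \<psi> ` V"
  shows "frechet_derivative (\<lambda>z. frechet_derivative Y (at z) (X z)) (at z) w
    = frechet_derivative (\<lambda>y. frechet_derivative Y (at y) (X z)) (at z) w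
      + frechet_derivative Y (at z) (frechet_derivative X (at z) w)"
proof -
  note dX = smooth_on_imp_has_derivative[OF X z]
  have expand: "frechet_derivative Y (at y) v = (\<Sum>b\<in>Basis. (v \<bullet> b) *\<^sub>R frechet_derivative Y (at y) b)"
    if "y \<in> \<psi> ` V" for y v
    by (rule frechet_derivative_expand_basis[OF smooth_on_imp_differentiable[OF Y that]])
  have dY: "((\<lambda>y. frechet_derivative Y (at y) b) has_derivative
      frechet_derivative (\<lambda>y. frechet_derivative Y (at y) b) (at z)) (at z)" for b
    by (rule smooth_on_imp_has_derivative[OF smooth_on_dir_derivative[OF Y] z])
  have "((\<lambda>z. \<Sum>b\<in>Basis. (X z \<bullet> b) *\<^sub>R frechet_derivative Y (at z) b) has_derivative
      (\<lambda>w. \<Sum>b\<in>Basis. (X z \<bullet> b) *\<^sub>R frechet_derivative (\<lambda>y. frechet_derivative Y (at y) b) (at z) w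
        + (frechet_derivative X (at z) w \<bullet> b) *\<^sub>R frechet_derivative Y (at z) b)) (at z)"
    by (intro has_derivative_sum has_derivative_scaleR has_derivative_inner_left dX dY)
  from frechet_derivative_eqI[OF this, of w]
  have l: "frechet_derivative (\<lambda>z. \<Sum>b\<in>Basis. (X z \<bullet> b) *\<^sub>R frechet_derivative Y (at z) b) (at z) w
    = (\<Sum>b\<in>Basis. (X z \<bullet> b) *\<^sub>R frechet_derivative (\<lambda>y. frechet_derivative Y (at y) b) (at z) w)
      + frechet_derivative Y (at z) (frechet_derivative X (at z) w)"
    by (simp add: sum.distrib expand[OF z, of "frechet_derivative X (at z) w"])
  have "((\<lambda>y. \<Sum>b\<in>Basis. (X z \<bullet> b) *\<^sub>R frechet_derivative Y (at y) b) has_derivative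
      (\<lambda>w. \<Sum>b\<in>Basis. (X z \<bullet> b) *\<^sub>R frechet_derivative (\<lambda>y. frechet_derivative Y (at y) b) (at z) w)) (at z)"
    by (intro has_derivative_sum has_derivative_scaleR_right dY)
  from frechet_derivative_eqI[OF this, of w]
  have r: "frechet_derivative (\<lambda>y. \<Sum>b\<in>Basis. (X z \<bullet> b) *\<^sub>R frechet_derivative Y (at y) b) (at z) w
    = (\<Sum>b\<in>Basis. (X z \<bullet> b) *\<^sub>R frechet_derivative (\<lambda>y. frechet_derivative Y (at y) b) (at z) w)" .
  have "frechet_derivative (\<lambda>z. frechet_derivative Y (at z) (X z)) (at z)
      = frechet_derivative (\<lambda>z. \<Sum>b\<in>Basis. (X z \<bullet> b) *\<^sub>R frechet_derivative Y (at z) b) (at z)"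
    "frechet_derivative (\<lambda>y. frechet_derivative Y (at y) (X z)) (at z)
      = frechet_derivative (\<lambda>y. \<Sum>b\<in>Basis. (X z \<bullet> b) *\<^sub>R frechet_derivative Y (at y) b) (at z)"
    by (rule frechet_derivative_cong_open[OF open_range z expand], assumption)+
  then show ?thesis using l r by simp
qed

lemma nabla_nabla:
  assumes X: "smooth_on (\<psi> ` V) X" and Y: "smooth_on (\<psi> ` V) Y" and Z: "smooth_on (\<psi> ` V) Z"
    and z: "z \<in> \<psi> ` V"
  shows "nabla X (nabla Y Z) z
    = frechet_derivative (\<lambda>y. frechet_derivative Z (at y) (Y z)) (at z) (X z)
      + frechet_derivative Z (at z) (frechet_derivative Y (at z) (X z))
      + christoffel_deriv z (X z) (Y z) (Z z)
      + christoffel z (frechet_derivative Y (at z) (X z)) (Z z)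
      + christoffel z (Y z) (frechet_derivative Z (at z) (X z))
      + christoffel z (X z) (frechet_derivative Z (at z) (Y z))
      + christoffel z (X z) (christoffel z (Y z) (Z z))"
proof -
  let ?A = "\<lambda>z. frechet_derivative Z (at z) (Y z)" and ?B = "\<lambda>z. christoffel z (Y z) (Z z)"
  have A: "smooth_on (\<psi> ` V) ?A" and B: "smooth_on (\<psi> ` V) ?B"
    by (intro smooth_on_apply_derivative smooth_on_christoffel open_range Y Z)+
  have "frechet_derivative (nabla Y Z) (at z) = frechet_derivative (\<lambda>z. ?A z + ?B z) (at z)"
    by (rule frechet_derivative_cong_open[OF open_range z]) (rule nabla_eq_christoffel[OF Y Z])
  moreover have "frechet_derivative (\<lambda>z. ?A z + ?B z) (at z) w
      = frechet_derivative ?A (at z) w + frechet_derivative ?B (at z) w" for w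
    by (rule frechet_derivative_eqI, rule has_derivative_add)
      (rule smooth_on_imp_has_derivative[OF A z] smooth_on_imp_has_derivative[OF B z])+
  ultimately show ?thesis
    by (simp add: nabla_eq_christoffel[OF X smooth_on_nabla[OF Y Z] z] nabla_eq_christoffel[OF Y Z z]
        derivative_directional_derivative[OF Y Z z] derivative_christoffel_fields[OF Y Z z]
        bilinear_radd[OF bilinear_christoffel])
qed

definition riemann :: "'k \<Rightarrow> 'k \<Rightarrow> 'k \<Rightarrow> 'k \<Rightarrow> 'k" where
  "riemann z u v w = christoffel_deriv z u v w - christoffel_deriv z v u w
     + christoffel z u (christoffel z v w) - christoffel z v (christoffel z u w)"

text \<open>The second derivatives of \<open>Z\<close> cancel because they are symmetric, the first derivatives of \<open>Z\<close> because
  they occur symmetrically in \<open>X\<close> and \<open>Y\<close>, and those of \<open>X\<close> and \<open>Y\<close> against the bracket, whose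
  Christoffel terms cancel by symmetry.\<close>

lemma nabla_curvature:
  assumes X: "smooth_on (\<psi> ` V) X" and Y: "smooth_on (\<psi> ` V) Y" and Z: "smooth_on (\<psi> ` V) Z"
    and z: "z \<in> \<psi> ` V"
  shows "nabla X (nabla Y Z) z - nabla Y (nabla X Z) z - nabla (\<lambda>z. nabla X Y z - nabla Y X z) Z z
    = riemann z (X z) (Y z) (Z z)"
proof -
  have B: "smooth_on (\<psi> ` V) (\<lambda>z. nabla X Y z - nabla Y X z)"
    by (intro smooth_on_diff smooth_on_nabla open_range X Y)
  have b: "nabla X Y z - nabla Y X z = frechet_derivative Y (at z) (X z) - frechet_derivative X (at z) (Y z)"
    by (simp add: nabla_eq_christoffel X Y z christoffel_symmetric[OF z, of "X z"])
  show ?thesis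
    unfolding nabla_nabla[OF X Y Z z] nabla_nabla[OF Y X Z z] nabla_eq_christoffel[OF B Z z] b
      symmetric_second_derivative[OF open_range z Z, of "Y z" "X z"] riemann_def
    by (simp add: linear_diff[OF smooth_on_imp_linear_derivative[OF Z z]] bilinear_lsub[OF bilinear_christoffel])
qed

text \<open>The curvature at a point depends on the values of the three fields there only. The rank of a
  Jacobi operator is defined by letting it act on all local fields, so this is what bounds it by the
  rank of a linear map.\<close>

lemma curvature_eq_riemann:
  assumes X: "smooth_vfield M V X" and Y: "smooth_vfield M V Y" and Z: "smooth_vfield M V Z"
    and q: "q \<in> V"
  shows "curvature M D X Y Z q = coord_vec q (riemann (\<psi> q)
    (coord_comp q (X q)) (coord_comp q (Y q)) (coord_comp q (Z q)))"
proof -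
  let ?r = coord_rep
  note r = smooth_on_coord_rep[OF X] smooth_on_coord_rep[OF Y] smooth_on_coord_rep[OF Z]
  note sD = smooth_vfield_connection[OF affine open_domain]
  have rep: "?r (D A B) z = nabla (?r A) (?r B) z"
    if "smooth_vfield M V A" "smooth_vfield M V B" "z \<in> \<psi> ` V" for A B z
    using that by (auto simp: coord_rep_def[of "D A B"] inverse connection_eq_nabla coord_field_def coord_comp_coord_vec)
  have DD: "D A (D B Z) q = coord_vec q (nabla (?r A) (nabla (?r B) (?r Z)) (\<psi> q))"
    if A: "smooth_vfield M V A" and B: "smooth_vfield M V B" for A B
  proof -
    have "D A (D B Z) q = coord_vec q (nabla (?r A) (?r (D B Z)) (\<psi> q))"
      using connection_eq_nabla[OF A sD[OF B Z] q] by (simp add: coord_field_def)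
    also have "nabla (?r A) (?r (D B Z)) (\<psi> q) = nabla (?r A) (nabla (?r B) (?r Z)) (\<psi> q)"
      by (rule nabla_cong) (use q in \<open>auto intro!: smooth_on_coord_rep A sD B Z rep\<close>)
    finally show ?thesis .
  qed
  let ?B = "\<lambda>z. nabla (?r X) (?r Y) z - nabla (?r Y) (?r X) z"
  have "lie_bracket M X Y p = coord_field ?B p" if p: "p \<in> V" for p
  proof -
    have "lie_bracket M X Y p = (\<lambda>c. D X Y p c - D Y X p c)"
      using torsion open_domain X Y p unfolding torsion_free_def by metis
    then show ?thesis
      using p by (simp add: connection_eq_nabla X Y coord_field_def coord_vec_diff fun_eq_iff)
  qed
  then have "D (lie_bracket M X Y) Z q = D (coord_field ?B) (coord_field (?r Z)) q"
    by (intro connection_local[symmetric])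
      (use q in \<open>auto simp: coord_field_coord_rep[OF Z] intro!: smooth_vfield_coord_field smooth_on_diff
        smooth_on_nabla open_range r\<close>)
  also have "\<dots> = coord_vec q (nabla ?B (?r Z) (\<psi> q))"
    by (intro connection_coord_field smooth_on_diff smooth_on_nabla open_range r q)
  finally have "curvature M D X Y Z q = coord_vec q (nabla (?r X) (nabla (?r Y) (?r Z)) (\<psi> q)
      - nabla (?r Y) (nabla (?r X) (?r Z)) (\<psi> q) - nabla ?B (?r Z) (\<psi> q))"
    using q by (simp add: curvature_def DD X Y coord_vec_diff fun_eq_iff)
  then show ?thesis
    using q by (simp add: nabla_curvature[OF r] coord_rep_def inverse)
qed

end


section \<open>The Levi-Civita connection of a split metric\<close>

lemma pseudo_riemannianD:
  assumes "pseudo_riemannian M" "p \<in> points M"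
  shows metric_symmetric: "v \<in> tangent_space M p \<Longrightarrow> w \<in> tangent_space M p \<Longrightarrow>
      metric M p v w = metric M p w v"
    and metric_linear: "u \<in> tangent_space M p \<Longrightarrow> v \<in> tangent_space M p \<Longrightarrow> w \<in> tangent_space M p \<Longrightarrow>
      metric M p (\<lambda>c. a *\<^sub>R u c + b *\<^sub>R v c) w = a * metric M p u w + b * metric M p v w"
    and metric_nondegenerate: "v \<in> tangent_space M p \<Longrightarrow>
      (\<And>w. w \<in> tangent_space M p \<Longrightarrow> metric M p v w = 0) \<Longrightarrow> v = (\<lambda>c. 0)"
proof -
  have *: "(\<forall>v\<in>tangent_space M p. \<forall>w\<in>tangent_space M p. metric M p v w = metric M p w v) \<and>
    (\<forall>u\<in>tangent_space M p. \<forall>v\<in>tangent_space M p. \<forall>w\<in>tangent_space M p. \<forall>a b.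
       metric M p (\<lambda>c. a *\<^sub>R u c + b *\<^sub>R v c) w = a * metric M p u w + b * metric M p v w) \<and>
    (\<forall>v\<in>tangent_space M p. (\<forall>w\<in>tangent_space M p. metric M p v w = 0) \<longrightarrow> v = (\<lambda>c. 0))"
    using assms(1)[unfolded pseudo_riemannian_def, THEN conjunct2, THEN conjunct1, THEN bspec, OF assms(2)] .
  show "v \<in> tangent_space M p \<Longrightarrow> w \<in> tangent_space M p \<Longrightarrow> metric M p v w = metric M p w v"
    by (rule *[THEN conjunct1, rule_format])
  show "u \<in> tangent_space M p \<Longrightarrow> v \<in> tangent_space M p \<Longrightarrow> w \<in> tangent_space M p \<Longrightarrow>
      metric M p (\<lambda>c. a *\<^sub>R u c + b *\<^sub>R v c) w = a * metric M p u w + b * metric M p v w"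
    by (rule *[THEN conjunct2, THEN conjunct1, rule_format])
  show "v \<in> tangent_space M p \<Longrightarrow> (\<And>w. w \<in> tangent_space M p \<Longrightarrow> metric M p v w = 0) \<Longrightarrow> v = (\<lambda>c. 0)"
    by (rule *[THEN conjunct2, THEN conjunct2, rule_format])
qed

lemma smooth_metric:
  "pseudo_riemannian M \<Longrightarrow> open_in M U \<Longrightarrow> smooth_vfield M U X \<Longrightarrow> smooth_vfield M U Y \<Longrightarrow>
    smooth_function M U (\<lambda>p. metric M p (X p) (Y p))"
  by (simp add: pseudo_riemannian_def)

locale metric_in_coordinates = connection_in_coordinates M V \<psi> \<eta> D
  for M :: "('p, 'e::euclidean_space) pr_manifold"
    and V :: "'p set" and \<psi> :: "'p \<Rightarrow> 'k::euclidean_space" and \<eta> :: "'k \<Rightarrow> 'p"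
    and D :: "('p, 'e) vfield \<Rightarrow> ('p, 'e) vfield \<Rightarrow> ('p, 'e) vfield" +
  assumes pseudo_riemannian: "pseudo_riemannian M"
    and compatible: "metric_compatible M D"
begin

definition coord_metric :: "'k \<Rightarrow> 'k \<Rightarrow> 'k \<Rightarrow> real" where
  "coord_metric z u v = metric M (\<eta> z) (coord_vec (\<eta> z) u) (coord_vec (\<eta> z) v)"

lemma coord_metric_symmetric:
  "z \<in> \<psi> ` V \<Longrightarrow> coord_metric z u v = coord_metric z v u"
proof -
  assume "z \<in> \<psi> ` V"
  then obtain q where "q \<in> V" "z = \<psi> q" by auto
  then show ?thesis
    using metric_symmetric[OF pseudo_riemannian, of q "coord_vec q u" "coord_vec q v"] domain_subset
    by (simp add: coord_metric_def inverse coord_vec_in_tangent_space subsetD)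
qed

lemma coord_metric_add:
  assumes "z \<in> \<psi> ` V"
  shows "coord_metric z (u + v) w = coord_metric z u w + coord_metric z v w"
proof -
  obtain q where q: "q \<in> V" "z = \<psi> q" using assms by auto
  have lin: "metric M q (\<lambda>c. a *\<^sub>R x c + b *\<^sub>R y c) w = a * metric M q x w + b * metric M q y w"
    if "x \<in> tangent_space M q" "y \<in> tangent_space M q" "w \<in> tangent_space M q" for a b x y w
    by (rule metric_linear[OF pseudo_riemannian subsetD[OF domain_subset q(1)] that])
  have "coord_vec q (u + v) = (\<lambda>c. 1 *\<^sub>R coord_vec q u c + 1 *\<^sub>R coord_vec q v c)"
    using coord_vec_add[OF q(1)] by (auto simp: fun_eq_iff)
  then show ?thesis
    using lin[of "coord_vec q u" "coord_vec q v" "coord_vec q w" 1 1] q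
    by (simp add: coord_metric_def inverse coord_vec_in_tangent_space)
qed

lemma coord_metric_diff:
  "z \<in> \<psi> ` V \<Longrightarrow> coord_metric z (u - v) w = coord_metric z u w - coord_metric z v w"
  using coord_metric_add[of z "u - v" v w] by simp

lemma coord_metric_nondegenerate:
  assumes "z \<in> \<psi> ` V" "\<And>w. coord_metric z u w = 0"
  shows "u = 0"
proof -
  obtain q where q: "q \<in> V" "z = \<psi> q" using assms(1) by auto
  have "metric M q (coord_vec q u) w = 0" if "w \<in> tangent_space M q" for w
    using assms(2)[of "coord_comp q w"] q coord_vec_coord_comp[OF q(1) that]
    by (simp add: coord_metric_def inverse)
  then have "coord_vec q u = (\<lambda>c. 0)"
    by (rule metric_nondegenerate[OF pseudo_riemannian subsetD[OF domain_subset q(1)]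
        coord_vec_in_tangent_space[OF q(1)]])
  also have "\<dots> = coord_vec q 0" using coord_vec_zero[OF q(1)] by auto
  finally show ?thesis using coord_comp_coord_vec[OF q(1)] by metis
qed

lemma smooth_function_metric:
  "smooth_function M V (\<lambda>q. metric M q (coord_field (\<lambda>z. u) q) (coord_field (\<lambda>z. v) q))"
  by (intro smooth_metric pseudo_riemannian open_domain smooth_vfield_coord_field smooth_on_const)

lemma smooth_on_coord_metric: "smooth_on (\<psi> ` V) (\<lambda>z. coord_metric z u v)"
  using smooth_on_smooth_function[OF smooth_function_metric[of u v]]
  by (rule smooth_on_cong[OF open_range, rotated]) (auto simp: coord_metric_def coord_field_def)

lemma coord_metric_derivative:
  assumes "z \<in> \<psi> ` V"
  shows "frechet_derivative (\<lambda>z. coord_metric z v w) (at z) u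
    = coord_metric z (christoffel z u v) w + coord_metric z v (christoffel z u w)"
proof -
  obtain q where q: "q \<in> V" "z = \<psi> q" using assms by auto
  let ?E = "\<lambda>u. coord_field (\<lambda>z. u)"
  have "dir_deriv M q (?E u q) (\<lambda>q. metric M q (?E v q) (?E w q))
      = metric M q (D (?E u) (?E v) q) (?E w q) + metric M q (?E v q) (D (?E u) (?E w) q)"
    using compatible[unfolded metric_compatible_def, rule_format, OF open_domain
        smooth_vfield_coord_field smooth_vfield_coord_field smooth_vfield_coord_field q(1)]
    by (simp add: smooth_on_const)
  moreover have "dir_deriv M q (?E u q) (\<lambda>q. metric M q (?E v q) (?E w q))
      = frechet_derivative (\<lambda>z. coord_metric z v w) (at z) u"
    using dir_deriv_coord_vec[OF q(1) smooth_function_metric[of v w]]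
    by (simp add: coord_metric_def coord_field_def q(2))
  moreover have "D (?E u) (?E v) q = coord_vec q (christoffel z u v)" for u v
    using q by (simp add: connection_coord_field smooth_on_const christoffel_eq_nabla)
  ultimately show ?thesis
    using q by (simp add: coord_metric_def coord_field_def inverse)
qed

text \<open>Compatibility expresses each of the three derivatives by two Christoffel terms; by the symmetry of
  the Christoffel symbols, four of the six cancel.\<close>

lemma koszul:
  assumes "z \<in> \<psi> ` V"
  shows "2 * coord_metric z (christoffel z u v) w
    = frechet_derivative (\<lambda>z. coord_metric z v w) (at z) u
      + frechet_derivative (\<lambda>z. coord_metric z u w) (at z) v
      - frechet_derivative (\<lambda>z. coord_metric z u v) (at z) w"
  unfolding coord_metric_derivative[OF assms] christoffel_symmetric[OF assms, of v u]
    christoffel_symmetric[OF assms, of w u] christoffel_symmetric[OF assms, of w v]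
  using coord_metric_symmetric[OF assms, of "christoffel z u w" v]
    coord_metric_symmetric[OF assms, of "christoffel z v w" u] by linarith

end

text \<open>The coordinate space is the direct sum of the images of \<open>P\<close> and \<open>Q\<close>, and the metric is the sum of
  a metric on \<open>range P\<close> with coefficients depending on \<open>P z\<close> and a metric on \<open>range Q\<close>
  with coefficients depending on \<open>Q z\<close>. Two projections, instead of an explicit product, make the
  situation symmetric under exchange of the factors.\<close>

locale split_metric = metric_in_coordinates M V \<psi> \<eta> D
  for M :: "('p, 'e::euclidean_space) pr_manifold"
    and V :: "'p set" and \<psi> :: "'p \<Rightarrow> 'k::euclidean_space" and \<eta> :: "'k \<Rightarrow> 'p"
    and D :: "('p, 'e) vfield \<Rightarrow> ('p, 'e) vfield \<Rightarrow> ('p, 'e) vfield" +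
  fixes P Q :: "'k \<Rightarrow> 'k"
  assumes linear_P: "linear P" and linear_Q: "linear Q"
    and P_plus_Q: "P u + Q u = u"
    and P_P: "P (P u) = P u" and Q_Q: "Q (Q u) = Q u"
    and orthogonal: "z \<in> \<psi> ` V \<Longrightarrow> coord_metric z (P u) (Q v) = 0"
    and metric_P: "z \<in> \<psi> ` V \<Longrightarrow> z' \<in> \<psi> ` V \<Longrightarrow> P z = P z' \<Longrightarrow>
      coord_metric z (P u) (P v) = coord_metric z' (P u) (P v)"
    and metric_Q: "z \<in> \<psi> ` V \<Longrightarrow> z' \<in> \<psi> ` V \<Longrightarrow> Q z = Q z' \<Longrightarrow>
      coord_metric z (Q u) (Q v) = coord_metric z' (Q u) (Q v)"
begin

lemma P_Q: "P (Q u) = 0" and Q_P: "Q (P u) = 0"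
  using P_plus_Q[of "Q u"] P_plus_Q[of "P u"] by (simp_all add: P_P Q_Q)

text \<open>Through this, each fact about \<open>P\<close> below also holds with the factors exchanged.\<close>

lemma swap: "split_metric M V \<psi> \<eta> D Q P"
proof
  show "Q u + P u = u" for u using P_plus_Q[of u] by (simp add: add.commute)
  show "coord_metric z (Q u) (P v) = 0" if "z \<in> \<psi> ` V" for z u v
    using orthogonal[OF that, of v u] coord_metric_symmetric[OF that, of "Q u" "P v"] by simp
qed (rule linear_add[OF linear_P] linear_add[OF linear_Q] linear_cmul[OF linear_P] linear_cmul[OF linear_Q]
    P_P Q_Q | erule (2) metric_P metric_Q)+

lemma metric_split:
  assumes "z \<in> \<psi> ` V"
  shows "coord_metric z (P u) w = coord_metric z (P u) (P w)"
proof -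
  have "coord_metric z w (P u) = coord_metric z (P w) (P u) + coord_metric z (Q w) (P u)"
    using coord_metric_add[OF assms, of "P w" "Q w" "P u"] unfolding P_plus_Q .
  then show ?thesis
    using orthogonal[OF assms, of u w] coord_metric_symmetric[OF assms, of "P u"] by (metis add.right_neutral)
qed

lemma derivative_metric_mixed:
  assumes "z \<in> \<psi> ` V"
  shows "frechet_derivative (\<lambda>z. coord_metric z (P u) (Q v)) (at z) w = 0"
proof -
  have "frechet_derivative (\<lambda>z. coord_metric z (P u) (Q v)) (at z) = frechet_derivative (\<lambda>z. 0) (at z)"
    by (rule frechet_derivative_cong_open[OF open_range assms orthogonal])
  then show ?thesis by simp
qed

lemma derivative_metric_P_along_P:
  assumes z: "z \<in> \<psi> ` V" "z' \<in> \<psi> ` V" "P z = P z'"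
  shows "frechet_derivative (\<lambda>z. coord_metric z (P u) v) (at z) (P w)
    = frechet_derivative (\<lambda>z. coord_metric z (P u) v) (at z') (P w)"
proof (rule frechet_derivative_eq_along_lines[OF open_range z(1) open_range z(2)])
  fix t assume t: "z + t *\<^sub>R P w \<in> \<psi> ` V" "z' + t *\<^sub>R P w \<in> \<psi> ` V"
  show "coord_metric (z + t *\<^sub>R P w) (P u) v = coord_metric (z' + t *\<^sub>R P w) (P u) v"
    unfolding metric_split[OF t(1), of u v] metric_split[OF t(2), of u v]
    by (rule metric_P[OF t]) (simp add: linear_add[OF linear_P] z)
qed (rule smooth_on_imp_differentiable[OF smooth_on_coord_metric] z)+

lemma derivative_metric_P_along_Q:
  assumes z: "z \<in> \<psi> ` V"
  shows "frechet_derivative (\<lambda>z. coord_metric z (P u) v) (at z) (Q w) = 0"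
proof -
  have "frechet_derivative (\<lambda>z. coord_metric z (P u) v) (at z) (Q w)
      = frechet_derivative (\<lambda>y. coord_metric z (P u) v) (at z) (Q w)"
  proof (rule frechet_derivative_eq_along_lines[OF open_range z open_range z])
    fix t assume t: "z + t *\<^sub>R Q w \<in> \<psi> ` V"
    show "coord_metric (z + t *\<^sub>R Q w) (P u) v = coord_metric z (P u) v"
      unfolding metric_split[OF t(1), of u v] metric_split[OF z, of u v]
      by (rule metric_P[OF t z]) (simp add: linear_add[OF linear_P] linear_cmul[OF linear_P] P_Q)
  qed (rule smooth_on_imp_differentiable[OF smooth_on_coord_metric z] differentiable_const)+
  then show ?thesis by simp
qed

text \<open>In the Koszul formula for vectors \<open>P u\<close>, \<open>P v\<close>, \<open>Q w\<close>, two terms are derivatives of the vanishing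
  mixed part of the metric, and the third differentiates the \<open>P\<close>-part of the metric in a
  direction on which it does not depend.\<close>

lemma christoffel_P_P_in_P:
  assumes z: "z \<in> \<psi> ` V"
  shows "Q (christoffel z (P u) (P v)) = 0"
proof (rule coord_metric_nondegenerate[OF z])
  interpret swap: split_metric M V \<psi> \<eta> D Q P by (rule swap)
  fix w
  have "coord_metric z (Q (christoffel z (P u) (P v))) w = coord_metric z (Q (christoffel z (P u) (P v))) (Q w)"
    by (rule swap.metric_split[OF z])
  also have "\<dots> = coord_metric z (christoffel z (P u) (P v)) (Q w)"
    using orthogonal[OF z, of "christoffel z (P u) (P v)" w]
      coord_metric_add[OF z, of "P (christoffel z (P u) (P v))" "Q (christoffel z (P u) (P v))" "Q w"]
    by (simp add: P_plus_Q)
  also have "2 * \<dots> = 0"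
    using z by (simp add: koszul derivative_metric_mixed derivative_metric_P_along_Q)
  finally show "coord_metric z (Q (christoffel z (P u) (P v))) w = 0" by simp
qed

lemma christoffel_P_P:
  "z \<in> \<psi> ` V \<Longrightarrow> P (christoffel z (P u) (P v)) = christoffel z (P u) (P v)"
  using P_plus_Q[of "christoffel z (P u) (P v)"] by (simp add: christoffel_P_P_in_P)

lemma christoffel_P_Q:
  assumes z: "z \<in> \<psi> ` V"
  shows "christoffel z (P u) (Q v) = 0"
proof (rule coord_metric_nondegenerate[OF z])
  interpret swap: split_metric M V \<psi> \<eta> D Q P by (rule swap)
  fix w
  have "2 * coord_metric z (christoffel z (P u) (Q v)) w = 0"
    using z by (simp add: koszul derivative_metric_mixed derivative_metric_P_along_Q swap.derivative_metric_P_along_Q)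
  then show "coord_metric z (christoffel z (P u) (Q v)) w = 0" by simp
qed

text \<open>The Koszul formula for vectors in \<open>range P\<close> involves only derivatives of the \<open>P\<close>-part of the metric
  along \<open>range P\<close>, and these agree at points with the same image under \<open>P\<close>. By nondegeneracy they
  determine the Christoffel symbols.\<close>

lemma christoffel_P_P_local:
  assumes z: "z \<in> \<psi> ` V" "z' \<in> \<psi> ` V" "P z = P z'"
  shows "christoffel z (P u) (P v) = christoffel z' (P u) (P v)"
proof -
  let ?G = "christoffel z (P u) (P v)" and ?G' = "christoffel z' (P u) (P v)"
  have "coord_metric z (?G - ?G') w = 0" for w
  proof -
    have "2 * coord_metric z ?G (P w) = 2 * coord_metric z' ?G' (P w)"
      unfolding koszul[OF z(1)] koszul[OF z(2)] using derivative_metric_P_along_P[OF z] by simp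
    also have "coord_metric z' ?G' (P w) = coord_metric z' (P ?G') (P w)"
      by (simp add: christoffel_P_P[OF z(2)])
    also have "\<dots> = coord_metric z (P ?G') (P w)" by (rule metric_P[OF z, symmetric])
    also have "\<dots> = coord_metric z ?G' (P w)"
      by (simp add: christoffel_P_P[OF z(2)])
    finally have "coord_metric z (?G - ?G') (P w) = 0" by (simp add: coord_metric_diff[OF z(1)])
    moreover have "P (?G - ?G') = ?G - ?G'"
      by (simp add: linear_diff[OF linear_P] christoffel_P_P z)
    ultimately show ?thesis using metric_split[OF z(1), of "?G - ?G'" w] by simp
  qed
  from coord_metric_nondegenerate[OF z(1) this] show ?thesis by simp
qed

lemma differentiable_christoffel:
  "z \<in> \<psi> ` V \<Longrightarrow> (\<lambda>z. christoffel z u v) differentiable (at z)"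
  using smooth_on_imp_differentiable[OF smooth_on_christoffel[OF smooth_on_const smooth_on_const]] .

lemma christoffel_deriv_P_Q:
  assumes z: "z \<in> \<psi> ` V"
  shows "christoffel_deriv z w (P u) (Q v) = 0"
proof -
  have "frechet_derivative (\<lambda>z. christoffel z (P u) (Q v)) (at z) = frechet_derivative (\<lambda>z. 0) (at z)"
    by (rule frechet_derivative_cong_open[OF open_range z christoffel_P_Q])
  then show ?thesis by (simp add: christoffel_deriv_def)
qed

lemma christoffel_deriv_P_P_along_Q:
  assumes z: "z \<in> \<psi> ` V"
  shows "christoffel_deriv z (Q w) (P u) (P v) = 0"
proof -
  have "frechet_derivative (\<lambda>z. christoffel z (P u) (P v)) (at z) (Q w)
      = frechet_derivative (\<lambda>y. christoffel z (P u) (P v)) (at z) (Q w)"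
  proof (rule frechet_derivative_eq_along_lines[OF open_range z open_range z])
    fix t assume t: "z + t *\<^sub>R Q w \<in> \<psi> ` V"
    show "christoffel (z + t *\<^sub>R Q w) (P u) (P v) = christoffel z (P u) (P v)"
      by (rule christoffel_P_P_local[OF t z]) (simp add: linear_add[OF linear_P] linear_cmul[OF linear_P] P_Q)
  qed (rule differentiable_christoffel[OF z] differentiable_const)+
  then show ?thesis by (simp add: christoffel_deriv_def)
qed

text \<open>All contributions of \<open>Q y\<close> vanish: mixed Christoffel symbols are zero, the others preserve the two factors,
  and those of one factor do not vary along the other.\<close>

lemma riemann_P:
  assumes z: "z \<in> \<psi> ` V"
  shows "riemann z (P u) y y = riemann z (P u) (P y) (P y)"
proof -
  interpret swap: split_metric M V \<psi> \<eta> D Q P by (rule swap)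
  note G = bilinear_radd[OF bilinear_christoffel] bilinear_ladd[OF bilinear_christoffel]
  note dG = bilinear_radd[OF linear_christoffel_deriv(2)[OF z]] bilinear_ladd[OF linear_christoffel_deriv(2)[OF z]]
    linear_add[OF linear_christoffel_deriv(1)[OF z]]
  note PQ = christoffel_P_Q[OF z] swap.christoffel_P_Q[OF z] christoffel_deriv_P_Q[OF z]
    swap.christoffel_deriv_P_Q[OF z] christoffel_deriv_P_P_along_Q[OF z] swap.christoffel_deriv_P_P_along_Q[OF z]
  have PG: "christoffel z (P u) (christoffel z (Q y) (Q y)) = 0"
    using christoffel_P_Q[OF z, of u "christoffel z (Q y) (Q y)"] by (simp add: swap.christoffel_P_P[OF z])
  have QG: "christoffel z (Q y) (christoffel z (P u) (P y)) = 0"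
    using swap.christoffel_P_Q[OF z, of y "christoffel z (P u) (P y)"] by (simp add: christoffel_P_P[OF z])
  have "riemann z (P u) (P y + Q y) (P y + Q y) = riemann z (P u) (P y) (P y)"
    unfolding riemann_def by (simp add: G dG PQ PG QG)
  then show ?thesis by (simp add: P_plus_Q)
qed

text \<open>The Jacobi operator of \<open>y\<close> agrees on \<open>range P\<close> with that of \<open>P y\<close>. It kills \<open>P y\<close>, by
  antisymmetry of the curvature, and it is zero on \<open>range P\<close> if \<open>P y = 0\<close>.\<close>

lemma jacobi_kernel_in_P:
  assumes z: "z \<in> \<psi> ` V" and "P u \<noteq> 0"
  shows "\<exists>a. a \<noteq> 0 \<and> P a = a \<and> riemann z a y y = 0"
proof (cases "P y = 0")
  case True
  have "riemann z (P u) 0 0 = 0"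
    using bilinear_lzero[OF bilinear_christoffel] bilinear_rzero[OF bilinear_christoffel]
      bilinear_lzero[OF linear_christoffel_deriv(2)[OF z]] bilinear_rzero[OF linear_christoffel_deriv(2)[OF z]]
    by (simp add: riemann_def)
  then show ?thesis using riemann_P[OF z, of u y] True assms P_P by metis
next
  case False
  have "riemann z (P y) (P y) (P y) = 0" by (simp add: riemann_def)
  then show ?thesis using riemann_P[OF z, of y y] False P_P by metis
qed

lemma connection_in_coordinates_restrict:
  assumes "open_in M V'" "V' \<subseteq> V"
  shows "connection_in_coordinates M V' \<psi> \<eta> D"
proof -
  interpret r: coordinates M V' \<psi> \<eta> by (rule coordinates_restrict[OF assms])
  show ?thesis by unfold_locales (rule affine torsion)+
qed

text \<open>The kernel of the Jacobi operator contains a nonzero vector from each factor. These two vectors are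
  independent, whatever the field \<open>\<xi>\<close> is.\<close>

lemma rank_jacobi_operator_le:
  assumes q: "q \<in> V" and U: "open_in M U" "q \<in> U" and \<xi>: "smooth_vfield M U \<xi>"
    and P: "P u \<noteq> 0" and Q: "Q v \<noteq> 0"
  shows "tensor_rank M (jacobi_operator M D \<xi>) q + 2 \<le> DIM('e)"
proof -
  interpret swap: split_metric M V \<psi> \<eta> D Q P by (rule swap)
  define y where "y = coord_comp q (\<xi> q)"
  define L where "L x = coord_vec q (riemann (\<psi> q) x y y) (some_chart M q)" for x
  have z: "\<psi> q \<in> \<psi> ` V" using q by blast
  have "linear (\<lambda>x. riemann (\<psi> q) x y y)"
    using linear_add[OF linear_christoffel_deriv(1)[OF z]] linear_cmul[OF linear_christoffel_deriv(1)[OF z]]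
      bilinear_ladd[OF linear_christoffel_deriv(2)[OF z]] bilinear_lmul[OF linear_christoffel_deriv(2)[OF z]]
    by (intro linearI) (simp_all add: riemann_def algebra_simps bilinear_ladd[OF bilinear_christoffel]
        bilinear_radd[OF bilinear_christoffel] bilinear_lmul[OF bilinear_christoffel] bilinear_rmul[OF bilinear_christoffel])
  then have L: "linear L"
    unfolding L_def using linear_compose[OF _ linear_coord_vec[OF q]] by (simp add: comp_def)
  obtain a where a: "a \<noteq> 0" "P a = a" "riemann (\<psi> q) a y y = 0"
    using jacobi_kernel_in_P[OF z P] by metis
  obtain b where b: "b \<noteq> 0" "Q b = b" "riemann (\<psi> q) b y y = 0"
    using swap.jacobi_kernel_in_P[OF z Q] by metis
  have "a \<noteq> t *\<^sub>R b" for t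
  proof
    assume "a = t *\<^sub>R b"
    then have "P a = t *\<^sub>R P (Q b)" using b linear_cmul[OF linear_P] by simp
    then show False using a by (simp add: P_Q)
  qed
  then have ab: "a \<notin> span {b}" by (auto simp: span_singleton)
  then have "independent {a, b}" "a \<noteq> b"
    using b by (auto simp: independent_insert span_base)
  then have "dim (range L) + 2 \<le> DIM('k)"
    using a b by (intro dim_range_two_kernel_vectors[OF L]) (auto simp: L_def coord_vec_zero[OF q])
  moreover have "{jacobi_operator M D \<xi> X q (some_chart M q) |X. \<exists>U. open_in M U \<and> q \<in> U \<and> smooth_vfield M U X} \<subseteq> range L"
  proof clarify
    fix X U' assume X: "open_in M U'" "q \<in> U'" "smooth_vfield M U' X"
    let ?V = "V \<inter> U \<inter> U'"
    interpret r: connection_in_coordinates M ?V \<psi> \<eta> D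
      by (rule connection_in_coordinates_restrict) (use open_domain U X in auto)
    have "jacobi_operator M D \<xi> X q = coord_vec q (riemann (\<psi> q) (coord_comp q (X q)) y y)"
      unfolding jacobi_operator_def y_def
      by (rule r.curvature_eq_riemann) (use q U X \<xi> in \<open>auto intro: smooth_vfield_subset\<close>)
    then show "jacobi_operator M D \<xi> X q (some_chart M q) \<in> range L" by (simp add: L_def)
  qed
  then have "tensor_rank M (jacobi_operator M D \<xi>) q \<le> dim (range L)"
    unfolding tensor_rank_def by (rule dim_subset)
  ultimately show ?thesis using dim_coords_le[OF q] by linarith
qed

end


section \<open>Coordinates adapted to a product\<close>

lemma coordinates_chart:
  assumes "smooth_manifold M" "c \<in> man_atlas M"
  shows "coordinates M (fst c) (snd c) (chart_inv c)"
proof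
  show "open_in M (fst c)" by (rule open_in_chart_domain[OF assms])
  fix d assume d: "d \<in> man_atlas M"
  show "open (snd c ` (fst c \<inter> fst d))"
    using open_chart_image[OF assms open_in_chart_domain[OF assms(1) d]] by (simp add: Int_commute)
  show "smooth_on (snd c ` (fst c \<inter> fst d)) (\<lambda>z. snd d (chart_inv c z))"
    using smooth_transition[OF assms d] by (simp add: transition_def comp_def)
  show "smooth_on (snd d ` (fst c \<inter> fst d)) (\<lambda>x. snd c (chart_inv d x))"
    using smooth_transition[OF assms(1) d assms(2)] by (simp add: transition_def comp_def Int_commute)
qed (use assms in \<open>auto simp: chart_inv_chart\<close>)

text \<open>The smoothness of \<open>F\<close> is that of the pulled back coordinates. The inverse of \<open>F\<close> gives the rest: its
  continuity makes the images of chart domains open, its smoothness is that of the inverse coordinates.\<close>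

lemma coordinates_diffeomorphism:
  assumes M: "smooth_manifold M" and U: "open_in M U" and bij: "bij_betw F U (points N)"
    and F: "smooth_map_on M U N F" and G: "smooth_map_on N (points N) M (inv_into U F)"
    and d: "d \<in> man_atlas N" "open_in N (fst d)" "inj_on (snd d) (fst d)"
    and open_d: "\<And>A. open_in N A \<Longrightarrow> A \<subseteq> fst d \<Longrightarrow> open (snd d ` A)"
  shows "coordinates M {q \<in> U. F q \<in> fst d} (\<lambda>q. snd d (F q)) (\<lambda>z. inv_into U F (chart_inv d z))"
proof
  let ?G = "inv_into U F" and ?V = "{q \<in> U. F q \<in> fst d}"
  have dN: "fst d \<subseteq> points N" using d(2) by (rule openin_subset)
  have UM: "U \<subseteq> points M" using U by (rule openin_subset)
  have GF: "?G (F q) = q" if "q \<in> U" for q using bij that by (rule bij_betw_inv_into_left)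
  have FG: "F (?G r) = r" "?G r \<in> U" if "r \<in> points N" for r
    using bij_betw_inv_into_right[OF bij that] inv_into_into[of r F U] that bij_betw_imp_surj_on[OF bij]
    by simp_all
  have inv: "chart_inv d (snd d r) = r" if "r \<in> fst d" for r
    using d(3) that by (simp add: chart_inv_def)
  show "smooth_manifold M" by (rule M)
  have "openin (subtopology (man_topology M) U) {q \<in> topspace (subtopology (man_topology M) U). F q \<in> fst d}"
    using F d(2) unfolding smooth_map_on_def by (intro openin_continuous_map_preimage[of _ "man_topology N"]) auto
  moreover have "{q \<in> topspace (subtopology (man_topology M) U). F q \<in> fst d} = ?V"
    using UM by auto
  ultimately show "open_in M ?V" using openin_open_subtopology[OF U] by simp
  show "?G (chart_inv d (snd d (F q))) = q" if "q \<in> ?V" for q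
    using that by (simp add: inv GF)
  fix c assume c: "c \<in> man_atlas M"
  have img: "(\<lambda>q. snd d (F q)) ` (?V \<inter> fst c) = snd d ` {r \<in> fst d \<inter> points N. ?G r \<in> fst c}"
  proof -
    have "F ` (?V \<inter> fst c) = {r \<in> fst d \<inter> points N. ?G r \<in> fst c}"
    proof (intro equalityI subsetI)
      fix r assume "r \<in> {r \<in> fst d \<inter> points N. ?G r \<in> fst c}"
      then show "r \<in> F ` (?V \<inter> fst c)"
        using FG by (intro image_eqI[of _ _ "?G r"]) auto
    qed (use dN GF in auto)
    then show ?thesis using image_image[of "snd d" F "?V \<inter> fst c"] by simp
  qed
  have "openin (subtopology (man_topology N) (points N)) {r \<in> topspace (subtopology (man_topology N) (points N)). ?G r \<in> fst c}"
    using G open_in_chart_domain[OF M c] unfolding smooth_map_on_def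
    by (intro openin_continuous_map_preimage[of _ "man_topology M"]) auto
  then have "open_in N ({r \<in> points N. ?G r \<in> fst c})" by simp
  then have "open_in N (fst d \<inter> {r \<in> points N. ?G r \<in> fst c})" by (rule openin_Int[OF d(2)])
  then have "open (snd d ` (fst d \<inter> {r \<in> points N. ?G r \<in> fst c}))" by (rule open_d) auto
  moreover have "fst d \<inter> {r \<in> points N. ?G r \<in> fst c} = {r \<in> fst d \<inter> points N. ?G r \<in> fst c}" by auto
  ultimately show "open ((\<lambda>q. snd d (F q)) ` (?V \<inter> fst c))" unfolding img by simp
  show "smooth_on ((\<lambda>q. snd d (F q)) ` (?V \<inter> fst c)) (\<lambda>z. snd c (?G (chart_inv d z)))"
    unfolding img using G c d(1) by (simp add: smooth_map_on_def comp_def)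
  have "?V \<inter> fst c = {q \<in> fst c \<inter> U. F q \<in> fst d}" by auto
  then show "smooth_on (snd c ` (?V \<inter> fst c)) (\<lambda>x. snd d (F (chart_inv c x)))"
    using F c d(1) by (simp add: smooth_map_on_def comp_def)
qed

text \<open>Two consecutive differentials are computed in two auxiliary charts, which the chain rule
  removes: all that enters is a local formula for \<open>\<pi> \<circ> F\<close> in the given coordinates.\<close>

lemma (in coordinates) differential_differential:
  fixes N :: "('q, 'f::euclidean_space, 'n) manifold_scheme"
    and R :: "('r, 'g::euclidean_space, 'o) manifold_scheme"
    and F :: "'p \<Rightarrow> 'q" and \<pi> :: "'q \<Rightarrow> 'r" and q k
  defines "c \<equiv> some_chart M q" and "d \<equiv> some_chart N (F q)"
  assumes q: "q \<in> V" and d: "d \<in> charts_at N (F q)" and e: "e \<in> charts_at R (\<pi> (F q))"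
    and F: "(\<lambda>x. snd d (F (chart_inv c x))) differentiable (at (snd c q))"
    and \<pi>: "(\<lambda>y. snd e (\<pi> (chart_inv d y))) differentiable (at (snd d (F q)))"
    and V': "open_in M V'" "V' \<subseteq> V" "q \<in> V'"
    and inv: "\<And>r. r \<in> V' \<Longrightarrow> chart_inv d (snd d (F r)) = F r"
    and eq: "\<And>r. r \<in> V' \<Longrightarrow> snd e (\<pi> (F r)) = g (\<psi> r)"
  shows "differential N R \<pi> (F q) (differential M N F q (coord_vec q k)) e
    = frechet_derivative g (at (\<psi> q)) k"
proof -
  have c: "c \<in> charts_at M q"
    unfolding c_def using q domain_subset by (auto intro!: some_chart_in_charts_at[OF manifold])
  have ci: "chart_inv c (snd c r) = r" if "r \<in> fst c" for r
    using that charts_atD[OF c] by (intro chart_inv_chart[OF manifold])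
  let ?V = "V' \<inter> fst c"
  interpret r: coordinates M ?V \<psi> \<eta>
    using V' open_in_chart_domain[OF manifold charts_atD(1)[OF c]]
    by (intro coordinates_restrict) auto
  have qV: "q \<in> ?V" using V' charts_atD[OF c] by simp
  have "differential N R \<pi> (F q) (differential M N F q (coord_vec q k)) e
      = frechet_derivative (\<lambda>y. snd e (\<pi> (chart_inv d y))) (at (snd d (F q)))
        (frechet_derivative (\<lambda>x. snd d (F (chart_inv c x))) (at (snd c q))
          (frechet_derivative (\<lambda>z. snd c (\<eta> z)) (at (\<psi> q)) k))"
    using d e c by (simp add: differential_def d_def[symmetric] c_def[symmetric] comp_def coord_vec_def)
  also have "frechet_derivative (\<lambda>x. snd d (F (chart_inv c x))) (at (snd c q))
          (frechet_derivative (\<lambda>z. snd c (\<eta> z)) (at (\<psi> q)) k)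
      = frechet_derivative (\<lambda>z. snd d (F (chart_inv c (snd c (\<eta> z))))) (at (\<psi> q)) k"
    using frechet_derivative_chain[of "\<lambda>x. snd d (F (chart_inv c x))" "\<lambda>z. snd c (\<eta> z)" "\<psi> q" k]
      F differentiable_inverse[OF q c] q by (simp add: inverse)
  also have "frechet_derivative (\<lambda>z. snd d (F (chart_inv c (snd c (\<eta> z))))) (at (\<psi> q))
      = frechet_derivative (\<lambda>z. snd d (F (\<eta> z))) (at (\<psi> q))"
    by (rule frechet_derivative_cong_open[OF r.open_range imageI[OF qV]]) (auto simp: r.inverse ci)
  also have "frechet_derivative (\<lambda>y. snd e (\<pi> (chart_inv d y))) (at (snd d (F q)))
        (frechet_derivative (\<lambda>z. snd d (F (\<eta> z))) (at (\<psi> q)) k)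
      = frechet_derivative (\<lambda>z. snd e (\<pi> (chart_inv d (snd d (F (\<eta> z)))))) (at (\<psi> q)) k"
  proof -
    have "(\<lambda>z. snd d (F (chart_inv c (snd c (\<eta> z))))) differentiable (at (\<psi> q))"
      using differentiable_chain_at[OF differentiable_inverse[OF q c], of "\<lambda>x. snd d (F (chart_inv c x))"]
        F q by (simp add: inverse comp_def)
    then have "(\<lambda>z. snd d (F (\<eta> z))) differentiable (at (\<psi> q))"
      by (rule differentiable_cong_open[OF r.open_range imageI[OF qV], rotated]) (auto simp: r.inverse ci)
    then show ?thesis
      using frechet_derivative_chain[of "\<lambda>y. snd e (\<pi> (chart_inv d y))" "\<lambda>z. snd d (F (\<eta> z))" "\<psi> q" k]
        \<pi> q by (simp add: inverse)
  qed
  also have "frechet_derivative (\<lambda>z. snd e (\<pi> (chart_inv d (snd d (F (\<eta> z)))))) (at (\<psi> q))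
      = frechet_derivative g (at (\<psi> q))"
    by (rule frechet_derivative_cong_open[OF r.open_range imageI[OF qV]]) (auto simp: r.inverse inv eq)
  finally show ?thesis .
qed

lemma man_topology_prod: "man_topology (prod_pr_manifold M1 M2) = prod_topology (man_topology M1) (man_topology M2)"
  and man_atlas_prod: "man_atlas (prod_pr_manifold M1 M2) = (\<lambda>(c1, c2). prod_chart c1 c2) ` (man_atlas M1 \<times> man_atlas M2)"
  and metric_prod: "metric (prod_pr_manifold M1 M2) r v w =
        metric M1 (fst r) (differential (prod_manifold M1 M2) M1 fst r v)
                          (differential (prod_manifold M1 M2) M1 fst r w) +
        metric M2 (snd r) (differential (prod_manifold M1 M2) M2 snd r v)
                          (differential (prod_manifold M1 M2) M2 snd r w)"
  unfolding prod_pr_manifold_def manifold.extend_def pr_manifold.fields_def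
  by (simp_all add: prod_manifold_def)

lemma man_atlas_prod_manifold:
  "man_atlas (prod_manifold M1 M2) = (\<lambda>(c1, c2). prod_chart c1 c2) ` (man_atlas M1 \<times> man_atlas M2)"
  by (simp add: prod_manifold_def)

lemma inj_on_prod_chart:
  assumes "smooth_manifold M1" "smooth_manifold M2" "c1 \<in> man_atlas M1" "c2 \<in> man_atlas M2"
  shows "inj_on (snd (prod_chart c1 c2)) (fst (prod_chart c1 c2))"
  unfolding prod_chart_def
  using map_prod_inj_on[OF inj_on_chart[OF assms(1,3)] inj_on_chart[OF assms(2,4)]] by simp

lemma prod_chart_inv:
  assumes "smooth_manifold M1" "smooth_manifold M2" "c1 \<in> man_atlas M1" "c2 \<in> man_atlas M2"
    "x \<in> fst c1" "y \<in> fst c2"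
  shows "chart_inv (prod_chart c1 c2) (snd c1 x, snd c2 y) = (x, y)"
  using inv_into_f_f[OF inj_on_prod_chart[OF assms(1-4)], of "(x, y)"] assms(5,6)
  by (simp add: chart_inv_def prod_chart_def)

lemma open_prod_chart_image:
  assumes M: "smooth_manifold M1" "smooth_manifold M2" and c: "c1 \<in> man_atlas M1" "c2 \<in> man_atlas M2"
    and A: "openin (prod_topology (man_topology M1) (man_topology M2)) A" "A \<subseteq> fst c1 \<times> fst c2"
  shows "open (map_prod (snd c1) (snd c2) ` A)"
proof (rule open_prod_intro)
  fix z assume "z \<in> map_prod (snd c1) (snd c2) ` A"
  then obtain r where r: "r \<in> A" "z = map_prod (snd c1) (snd c2) r" by (rule imageE)
  obtain x y where xy: "(x, y) \<in> A" "z = (snd c1 x, snd c2 y)" using r by (cases r) simp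
  obtain U1 U2 where U: "open_in M1 U1" "open_in M2 U2" "x \<in> U1" "y \<in> U2" "U1 \<times> U2 \<subseteq> A"
    using A(1)[unfolded openin_prod_topology_alt, rule_format, OF xy(1)] by metis
  let ?B = "snd c1 ` (U1 \<inter> fst c1)" and ?C = "snd c2 ` (U2 \<inter> fst c2)"
  have "open ?B" by (rule open_chart_image[OF M(1) c(1) U(1)])
  moreover have "open ?C" by (rule open_chart_image[OF M(2) c(2) U(2)])
  moreover have "z \<in> ?B \<times> ?C"
  proof -
    have "(x, y) \<in> fst c1 \<times> fst c2" using A(2) xy(1) by (rule subsetD)
    then show ?thesis using U(3,4) xy(2) by simp
  qed
  moreover have "?B \<times> ?C \<subseteq> map_prod (snd c1) (snd c2) ` A"
  proof
    fix w assume "w \<in> ?B \<times> ?C"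
    then obtain x' y' where w: "w = (snd c1 x', snd c2 y')" "x' \<in> U1" "y' \<in> U2"
      by (elim SigmaE imageE) simp
    then have "(x', y') \<in> A" using U(5) by (intro subsetD[OF U(5)] SigmaI)
    then show "w \<in> map_prod (snd c1) (snd c2) ` A"
      using w(1) by (intro image_eqI[of _ _ "(x', y')"]) simp_all
  qed
  ultimately show "\<exists>B C. open B \<and> open C \<and> z \<in> B \<times> C \<and> B \<times> C \<subseteq> map_prod (snd c1) (snd c2) ` A"
    by (intro exI conjI)
qed

lemma charts_at_prod:
  "charts_at (prod_manifold M1 M2) r = (\<lambda>(c1, c2). prod_chart c1 c2) ` (charts_at M1 (fst r) \<times> charts_at M2 (snd r))"
  unfolding charts_at_def man_atlas_prod_manifold
proof (intro equalityI subsetI)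
  fix c assume "c \<in> {c \<in> (\<lambda>(c1, c2). prod_chart c1 c2) ` (man_atlas M1 \<times> man_atlas M2). r \<in> fst c}"
  then obtain a b where "a \<in> man_atlas M1" "b \<in> man_atlas M2" "c = prod_chart a b" "r \<in> fst c"
    by (elim CollectE conjE imageE SigmaE) simp
  then show "c \<in> (\<lambda>(c1, c2). prod_chart c1 c2) ` ({c \<in> man_atlas M1. fst r \<in> fst c} \<times> {c \<in> man_atlas M2. snd r \<in> fst c})"
    by (intro image_eqI[of _ _ "(a, b)"]) (simp_all add: prod_chart_def mem_Times_iff)
next
  fix c assume "c \<in> (\<lambda>(c1, c2). prod_chart c1 c2) ` ({c \<in> man_atlas M1. fst r \<in> fst c} \<times> {c \<in> man_atlas M2. snd r \<in> fst c})"
  then obtain a b where "a \<in> man_atlas M1" "b \<in> man_atlas M2" "c = prod_chart a b" "r \<in> fst c"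
    by (elim CollectE conjE imageE SigmaE) (simp add: prod_chart_def mem_Times_iff)
  then show "c \<in> {c \<in> (\<lambda>(c1, c2). prod_chart c1 c2) ` (man_atlas M1 \<times> man_atlas M2). r \<in> fst c}"
    by (intro CollectI conjI image_eqI[of _ _ "(a, b)"]) simp_all
qed

locale product_isometry =
  fixes M :: "('p, 'e::euclidean_space) pr_manifold" and U :: "'p set"
    and M1 :: "('p1, 'e1::euclidean_space) pr_manifold" and M2 :: "('p2, 'e2::euclidean_space) pr_manifold"
    and F :: "'p \<Rightarrow> 'p1 \<times> 'p2" and c1 :: "('p1, 'e1) chart" and c2 :: "('p2, 'e2) chart"
  assumes M: "pseudo_riemannian M" and M1: "pseudo_riemannian M1" and M2: "pseudo_riemannian M2"
    and open_U: "open_in M U" and isometry: "isometry_from M U (prod_pr_manifold M1 M2) F"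
    and c1: "c1 \<in> man_atlas M1" and c2: "c2 \<in> man_atlas M2"
begin

abbreviation "N \<equiv> prod_pr_manifold M1 M2"

definition V :: "'p set" where "V = {q \<in> U. F q \<in> fst (prod_chart c1 c2)}"

definition \<psi> :: "'p \<Rightarrow> 'e1 \<times> 'e2" where "\<psi> q = snd (prod_chart c1 c2) (F q)"

definition \<eta> :: "'e1 \<times> 'e2 \<Rightarrow> 'p" where "\<eta> z = inv_into U F (chart_inv (prod_chart c1 c2) z)"

lemma manifolds: "smooth_manifold M" "smooth_manifold M1" "smooth_manifold M2"
  using M M1 M2 by (simp_all add: pseudo_riemannian_def)

lemma V_eq: "q \<in> V \<longleftrightarrow> q \<in> U \<and> fst (F q) \<in> fst c1 \<and> snd (F q) \<in> fst c2"
  by (auto simp: V_def prod_chart_def mem_Times_iff)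

lemma \<psi>_eq: "\<psi> q = (snd c1 (fst (F q)), snd c2 (snd (F q)))"
  by (simp add: \<psi>_def prod_chart_def map_prod_def split_beta)

lemma open_preimage:
  assumes "open_in M1 A" "open_in M2 B"
  shows "open_in M {q \<in> U. fst (F q) \<in> A \<and> snd (F q) \<in> B}"
proof -
  have "continuous_map (subtopology (man_topology M) U) (man_topology N) F"
    using isometry by (simp add: isometry_from_def smooth_map_on_def)
  moreover have "openin (man_topology N) (A \<times> B)"
    using assms by (simp add: man_topology_prod openin_prod_Times_iff)
  ultimately have "openin (subtopology (man_topology M) U) {q \<in> topspace (subtopology (man_topology M) U). F q \<in> A \<times> B}"
    by (rule openin_continuous_map_preimage)
  moreover have "{q \<in> topspace (subtopology (man_topology M) U). F q \<in> A \<times> B} = {q \<in> U. fst (F q) \<in> A \<and> snd (F q) \<in> B}"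
    using openin_subset[OF open_U] by (auto simp: mem_Times_iff)
  ultimately show ?thesis using openin_open_subtopology[OF open_U] by simp
qed

sublocale coordinates M V \<psi> \<eta>
  unfolding V_def \<psi>_def[abs_def] \<eta>_def[abs_def]
proof (rule coordinates_diffeomorphism[of M U F N])
  show "prod_chart c1 c2 \<in> man_atlas N"
    unfolding man_atlas_prod using c1 c2 by (intro image_eqI[of _ _ "(c1, c2)"]) simp_all
  show "open_in N (fst (prod_chart c1 c2))"
    using open_in_chart_domain[OF manifolds(2) c1] open_in_chart_domain[OF manifolds(3) c2]
    by (simp add: man_topology_prod prod_chart_def openin_prod_Times_iff)
  show "inj_on (snd (prod_chart c1 c2)) (fst (prod_chart c1 c2))"
    by (rule inj_on_prod_chart[OF manifolds(2,3) c1 c2])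
  show "open (snd (prod_chart c1 c2) ` A)" if "open_in N A" "A \<subseteq> fst (prod_chart c1 c2)" for A
    using open_prod_chart_image[OF manifolds(2,3) c1 c2 that[unfolded man_topology_prod prod_chart_def fst_conv]]
    by (simp add: prod_chart_def)
  show "bij_betw F U (points N)" "smooth_map_on M U N F" "smooth_map_on N (points N) M (inv_into U F)"
    using isometry unfolding isometry_from_def by simp_all
qed (rule manifolds open_U)+

sublocale c1: coordinates M1 "fst c1" "snd c1" "chart_inv c1"
  by (rule coordinates_chart[OF manifolds(2) c1])

sublocale c2: coordinates M2 "fst c2" "snd c2" "chart_inv c2"
  by (rule coordinates_chart[OF manifolds(3) c2])

text \<open>In the coordinates \<open>\<psi>\<close> and the charts \<open>c1\<close>, \<open>c2\<close>, the maps \<open>fst \<circ> F\<close> and \<open>snd \<circ> F\<close> are the two projections of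
  \<open>'e1 \<times> 'e2\<close>. Their differentials are therefore the same projections.\<close>

lemma differential_factors:
  assumes q: "q \<in> V"
  shows "differential (prod_manifold M1 M2) M1 fst (F q) (differential M N F q (coord_vec q k))
      = c1.coord_vec (fst (F q)) (fst k)"
    and "differential (prod_manifold M1 M2) M2 snd (F q) (differential M N F q (coord_vec q k))
      = c2.coord_vec (snd (F q)) (snd k)"
proof -
  let ?N = "prod_manifold M1 M2"
  define c where "c = some_chart M q"
  define d where "d = some_chart ?N (F q)"
  have same: "charts_at N r = charts_at ?N r" for r
    unfolding charts_at_def man_atlas_prod man_atlas_prod_manifold ..
  have diff: "differential M N F = differential M ?N F"
    unfolding differential_def[abs_def] same ..
  have F12: "fst (F q) \<in> fst c1" "snd (F q) \<in> fst c2" "q \<in> U" using q unfolding V_eq by simp_all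
  have c: "c \<in> charts_at M q"
    unfolding c_def by (rule some_chart_in_charts_at[OF manifolds(1) subsetD[OF domain_subset q]])
  have "prod_chart c1 c2 \<in> charts_at ?N (F q)"
    unfolding charts_at_prod using c1 c2 F12 by (intro image_eqI[of _ _ "(c1, c2)"]) (simp_all add: charts_at_def)
  then have d: "d \<in> charts_at ?N (F q)" unfolding d_def some_chart_def by (rule someI)
  then obtain d1 d2 where d12: "d = prod_chart d1 d2" "d1 \<in> charts_at M1 (fst (F q))" "d2 \<in> charts_at M2 (snd (F q))"
    unfolding charts_at_prod by (elim imageE SigmaE) simp
  note d1 = charts_atD[OF d12(2)] and d2 = charts_atD[OF d12(3)]
  have dF: "snd d (F r) = (snd d1 (fst (F r)), snd d2 (snd (F r)))" for r
    by (simp add: d12(1) prod_chart_def map_prod_def split_beta)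
  have inv: "chart_inv d (snd d1 x, snd d2 y) = (x, y)" if "x \<in> fst d1" "y \<in> fst d2" for x y
    unfolding d12(1) by (rule prod_chart_inv[OF manifolds(2,3) d1(1) d2(1) that])
  have Fd: "(\<lambda>x. snd d (F (chart_inv c x))) differentiable (at (snd c q))"
  proof (rule smooth_on_imp_differentiable)
    have "d \<in> man_atlas N" using d unfolding same[symmetric] by (rule charts_atD(1))
    then show "smooth_on (snd c ` {r \<in> fst c \<inter> U. F r \<in> fst d}) (\<lambda>x. snd d (F (chart_inv c x)))"
      using isometry charts_atD(1)[OF c] by (simp add: isometry_from_def smooth_map_on_def comp_def)
    show "snd c q \<in> snd c ` {r \<in> fst c \<inter> U. F r \<in> fst d}"
      using charts_atD(2)[OF c] charts_atD(2)[OF d] F12(3) by (intro imageI) simp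
  qed
  define V' where "V' = V \<inter> {r \<in> U. fst (F r) \<in> fst d1 \<and> snd (F r) \<in> fst d2}"
  have V': "open_in M V'" "V' \<subseteq> V" "q \<in> V'"
    unfolding V'_def using q F12(3) d1(2) d2(2)
    by (simp_all add: openin_Int[OF open_domain open_preimage] open_in_chart_domain manifolds d1(1) d2(1))
  have invF: "chart_inv d (snd d (F r)) = F r" if "r \<in> V'" for r
    using that inv by (simp add: dF V'_def)
  have open_d: "open ((snd d1 ` fst d1) \<times> (snd d2 ` fst d2))"
    using open_chart_image[OF manifolds(2) d1(1) open_in_chart_domain[OF manifolds(2) d1(1)]]
      open_chart_image[OF manifolds(3) d2(1) open_in_chart_domain[OF manifolds(3) d2(1)]]
    by (simp add: open_Times)
  have in_d: "snd d (F q) \<in> (snd d1 ` fst d1) \<times> (snd d2 ` fst d2)"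
    using d1 d2 by (simp add: dF)
  show "differential ?N M1 fst (F q) (differential M N F q (coord_vec q k)) = c1.coord_vec (fst (F q)) (fst k)"
  proof
    fix e
    show "differential ?N M1 fst (F q) (differential M N F q (coord_vec q k)) e = c1.coord_vec (fst (F q)) (fst k) e"
    proof (cases "e \<in> charts_at M1 (fst (F q))")
      case True
      have tr: "transition d1 e differentiable at (fst (snd d (F q)))"
        using transition_differentiable[OF manifolds(2) d12(2) True] by (simp add: dF)
      have "(\<lambda>y. transition d1 e (fst y)) differentiable (at (snd d (F q)))"
        using differentiable_chain_at[OF bounded_linear_imp_differentiable[OF bounded_linear_fst] tr]
        by (simp add: comp_def)
      then have "(\<lambda>y. snd e (fst (chart_inv d y))) differentiable (at (snd d (F q)))"
        by (rule differentiable_cong_open[OF open_d in_d, rotated])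
          (use d1 in \<open>auto simp: inv transition_def chart_inv_chart[OF manifolds(2)]\<close>)
      then have "differential ?N M1 fst (F q) (differential M ?N F q (coord_vec q k)) e
          = frechet_derivative (\<lambda>z. snd e (chart_inv c1 (fst z))) (at (\<psi> q)) k"
        using d True Fd V' invF unfolding c_def d_def
        by (intro differential_differential[OF q]) (auto simp: V_eq \<psi>_eq chart_inv_chart[OF manifolds(2) c1])
      also have "\<dots> = frechet_derivative (\<lambda>z. snd e (chart_inv c1 z)) (at (fst (\<psi> q))) (fst k)"
        using frechet_derivative_chain[of "\<lambda>z. snd e (chart_inv c1 z)" fst "\<psi> q" k]
          c1.differentiable_inverse[OF F12(1) True] bounded_linear_imp_differentiable[OF bounded_linear_fst, of "at (\<psi> q)"]
          frechet_derivative_eqI[OF bounded_linear_imp_has_derivative[OF bounded_linear_fst], of "\<psi> q" k]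
        by (simp add: \<psi>_eq)
      finally show ?thesis using True by (simp add: diff c1.coord_vec_def \<psi>_eq)
    qed (simp add: differential_def c1.coord_vec_def)
  qed
  show "differential ?N M2 snd (F q) (differential M N F q (coord_vec q k)) = c2.coord_vec (snd (F q)) (snd k)"
  proof
    fix e
    show "differential ?N M2 snd (F q) (differential M N F q (coord_vec q k)) e = c2.coord_vec (snd (F q)) (snd k) e"
    proof (cases "e \<in> charts_at M2 (snd (F q))")
      case True
      have tr: "transition d2 e differentiable at (snd (snd d (F q)))"
        using transition_differentiable[OF manifolds(3) d12(3) True] by (simp add: dF)
      have "(\<lambda>y. transition d2 e (snd y)) differentiable (at (snd d (F q)))"
        using differentiable_chain_at[OF bounded_linear_imp_differentiable[OF bounded_linear_snd] tr]
        by (simp add: comp_def)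
      then have "(\<lambda>y. snd e (snd (chart_inv d y))) differentiable (at (snd d (F q)))"
        by (rule differentiable_cong_open[OF open_d in_d, rotated])
          (use d2 in \<open>auto simp: inv transition_def chart_inv_chart[OF manifolds(3)]\<close>)
      then have "differential ?N M2 snd (F q) (differential M ?N F q (coord_vec q k)) e
          = frechet_derivative (\<lambda>z. snd e (chart_inv c2 (snd z))) (at (\<psi> q)) k"
        using d True Fd V' invF unfolding c_def d_def
        by (intro differential_differential[OF q]) (auto simp: V_eq \<psi>_eq chart_inv_chart[OF manifolds(3) c2])
      also have "\<dots> = frechet_derivative (\<lambda>z. snd e (chart_inv c2 z)) (at (snd (\<psi> q))) (snd k)"
        using frechet_derivative_chain[of "\<lambda>z. snd e (chart_inv c2 z)" snd "\<psi> q" k]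
          c2.differentiable_inverse[OF F12(2) True] bounded_linear_imp_differentiable[OF bounded_linear_snd, of "at (\<psi> q)"]
          frechet_derivative_eqI[OF bounded_linear_imp_has_derivative[OF bounded_linear_snd], of "\<psi> q" k]
        by (simp add: \<psi>_eq)
      finally show ?thesis using True by (simp add: diff c2.coord_vec_def \<psi>_eq)
    qed (simp add: differential_def c2.coord_vec_def)
  qed
qed

lemma metric_eq_sum:
  assumes "q \<in> V"
  shows "metric M q (coord_vec q u) (coord_vec q v)
    = metric M1 (fst (F q)) (c1.coord_vec (fst (F q)) (fst u)) (c1.coord_vec (fst (F q)) (fst v))
      + metric M2 (snd (F q)) (c2.coord_vec (snd (F q)) (snd u)) (c2.coord_vec (snd (F q)) (snd v))"
proof -
  have "metric M q (coord_vec q u) (coord_vec q v)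
      = metric N (F q) (differential M N F q (coord_vec q u)) (differential M N F q (coord_vec q v))"
    using isometry assms coord_vec_in_tangent_space by (simp add: isometry_from_def V_eq)
  then show ?thesis by (simp add: metric_prod differential_factors[OF assms])
qed

lemma metric_zero:
  assumes "q \<in> V"
  shows "metric M1 (fst (F q)) (c1.coord_vec (fst (F q)) 0) (c1.coord_vec (fst (F q)) a) = 0"
    "metric M1 (fst (F q)) (c1.coord_vec (fst (F q)) a) (c1.coord_vec (fst (F q)) 0) = 0"
    "metric M2 (snd (F q)) (c2.coord_vec (snd (F q)) 0) (c2.coord_vec (snd (F q)) b) = 0"
    "metric M2 (snd (F q)) (c2.coord_vec (snd (F q)) b) (c2.coord_vec (snd (F q)) 0) = 0"
proof -
  have F12: "fst (F q) \<in> fst c1" "snd (F q) \<in> fst c2" using assms by (auto simp: V_eq)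
  note p = subsetD[OF c1.domain_subset F12(1)] subsetD[OF c2.domain_subset F12(2)]
  note t = c1.coord_vec_in_tangent_space[OF F12(1)] c2.coord_vec_in_tangent_space[OF F12(2)]
  have z: "c1.coord_vec (fst (F q)) 0 = (\<lambda>c. 0)" "c2.coord_vec (snd (F q)) 0 = (\<lambda>c. 0)"
    using c1.coord_vec_zero[OF F12(1)] c2.coord_vec_zero[OF F12(2)] by auto
  show 1: "metric M1 (fst (F q)) (c1.coord_vec (fst (F q)) 0) (c1.coord_vec (fst (F q)) a) = 0" for a
    using metric_linear[OF M1 p(1) t(1) t(1) t(1), of 0 _ 0 _ a] by (simp add: z)
  show 2: "metric M2 (snd (F q)) (c2.coord_vec (snd (F q)) 0) (c2.coord_vec (snd (F q)) b) = 0" for b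
    using metric_linear[OF M2 p(2) t(2) t(2) t(2), of 0 _ 0 _ b] by (simp add: z)
  show "metric M1 (fst (F q)) (c1.coord_vec (fst (F q)) a) (c1.coord_vec (fst (F q)) 0) = 0"
    using 1 metric_symmetric[OF M1 p(1) t(1) t(1)] by metis
  show "metric M2 (snd (F q)) (c2.coord_vec (snd (F q)) b) (c2.coord_vec (snd (F q)) 0) = 0"
    using 2 metric_symmetric[OF M2 p(2) t(2) t(2)] by metis
qed

text \<open>The part of the metric that comes from the first factor is evaluated at \<open>fst (F q)\<close>. As the chart \<open>c1\<close> is
  injective, this point is determined by the first half of the coordinates of \<open>q\<close>; likewise for
  the second factor.\<close>

lemma split_metric:
  assumes D: "levi_civita_connection M D"
  shows "split_metric M V \<psi> \<eta> D (\<lambda>k. (fst k, 0)) (\<lambda>k. (0, snd k))"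
proof -
  interpret m: metric_in_coordinates M V \<psi> \<eta> D
    using D M by unfold_locales (simp_all add: levi_civita_connection_def)
  have h: "m.coord_metric (\<psi> q) u v
      = metric M1 (fst (F q)) (c1.coord_vec (fst (F q)) (fst u)) (c1.coord_vec (fst (F q)) (fst v))
        + metric M2 (snd (F q)) (c2.coord_vec (snd (F q)) (snd u)) (c2.coord_vec (snd (F q)) (snd v))"
    if "q \<in> V" for q u v
    using metric_eq_sum[OF that] by (simp add: m.coord_metric_def inverse[OF that])
  show ?thesis
  proof
    show "m.coord_metric z (fst u, 0) (0, snd v) = 0" if "z \<in> \<psi> ` V" for z u v
      using that by (auto simp: h metric_zero)
    fix z z' and u v :: "'e1 \<times> 'e2" assume "z \<in> \<psi> ` V" "z' \<in> \<psi> ` V"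
    then obtain q q' where q: "q \<in> V" "z = \<psi> q" "q' \<in> V" "z' = \<psi> q'" by auto
    show "m.coord_metric z (fst u, 0) (fst v, 0) = m.coord_metric z' (fst u, 0) (fst v, 0)"
      if "(fst z, 0) = (fst z', 0)"
    proof -
      have "fst (F q) = fst (F q')"
        using that q inj_onD[OF inj_on_chart[OF manifolds(2) c1], of "fst (F q)" "fst (F q')"]
        by (simp add: \<psi>_eq V_eq)
      then show ?thesis using q by (simp add: h metric_zero)
    qed
    show "m.coord_metric z (0, snd u) (0, snd v) = m.coord_metric z' (0, snd u) (0, snd v)"
      if "(0, snd z) = (0, snd z')"
    proof -
      have "snd (F q) = snd (F q')"
        using that q inj_onD[OF inj_on_chart[OF manifolds(3) c2], of "snd (F q)" "snd (F q')"]
        by (simp add: \<psi>_eq V_eq)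
      then show ?thesis using q by (simp add: h metric_zero)
    qed
  qed (auto intro!: linearI)
qed

end


section \<open>Local irreducibility\<close>

theorem corollary2:
  fixes M :: "('p, 'e::euclidean_space) pr_manifold"
    and D :: "('p, 'e) vfield \<Rightarrow> ('p, 'e) vfield \<Rightarrow> ('p, 'e) vfield"
  assumes "pseudo_riemannian M"
    and "levi_civita_connection M D"
    and "\<forall>p\<in>points M. \<exists>U \<xi>. open_in M U \<and> p \<in> U \<and> smooth_vfield M U \<xi> \<and>
           jacobi_maximal_rank M D U \<xi>"
  shows "locally_irreducible TYPE(('p1, 'e1::euclidean_space) pr_manifold)
           TYPE(('p2, 'e2::euclidean_space) pr_manifold) M"
  unfolding locally_irreducible_def
proof clarify
  fix p U and M1 :: "('p1, 'e1) pr_manifold" and M2 :: "('p2, 'e2) pr_manifold" and F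
  assume p: "p \<in> points M" "p \<in> U" and U: "open_in M U"
    and M12: "pseudo_riemannian M1" "pseudo_riemannian M2"
    and F: "isometry_from M U (prod_pr_manifold M1 M2) F"
  have "F p \<in> points (prod_pr_manifold M1 M2)"
    using F p by (auto simp: isometry_from_def dest: bij_betw_apply)
  then have pt: "fst (F p) \<in> points M1" "snd (F p) \<in> points M2"
    by (auto simp: man_topology_prod)
  define c1 where "c1 = some_chart M1 (fst (F p))"
  define c2 where "c2 = some_chart M2 (snd (F p))"
  have c: "c1 \<in> charts_at M1 (fst (F p))" "c2 \<in> charts_at M2 (snd (F p))"
    unfolding c1_def c2_def using M12 pt by (auto simp: pseudo_riemannian_def intro!: some_chart_in_charts_at)
  interpret product_isometry M U M1 M2 F c1 c2
    by unfold_locales (use assms(1) M12 U F c in \<open>auto simp: charts_at_def\<close>)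
  interpret s: split_metric M V \<psi> \<eta> D "\<lambda>k. (fst k, 0)" "\<lambda>k. (0, snd k)"
    by (rule split_metric[OF assms(2)])
  have V: "p \<in> V" using p c by (simp add: V_eq charts_at_def)
  obtain W \<xi> where W: "open_in M W" "p \<in> W" "smooth_vfield M W \<xi>" "jacobi_maximal_rank M D W \<xi>"
    using assms(3) p by blast
  obtain a :: 'e1 where a: "a \<in> Basis" using nonempty_Basis by blast
  obtain b :: 'e2 where b: "b \<in> Basis" using nonempty_Basis by blast
  have "tensor_rank M (jacobi_operator M D \<xi>) p + 2 \<le> DIM('e)"
    by (rule s.rank_jacobi_operator_le[OF V W(1-3), of "(a, 0)" "(0, b)"])
      (use a b in \<open>auto simp: zero_prod_def\<close>)
  then show False using W(2,4) by (simp add: jacobi_maximal_rank_def)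
qed

end
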